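(* Let $X$ be a complex surface, let $\eta\in H^0(X,S^3(\Omega^1_X))$ be a non-degenerate symmetric $3$-differential on $X$, and let $x\in X$. Suppose that $(z,w)$ are local holomorphic coordinates near $x$ and that $a(z,w)$, $b(z,w)$ are nowhere vanishing holomorphic functions near $x$ such that, near $x$, $$\eta=[a(z,w)\,dz+b(z,w)\,dw]\,dz\,dw .$$ Let $$A(z,w)=\partial_z\partial_w\log a,\qquad B(z,w)=\partial_z\partial_w\log b,$$ and suppose that $A-B$ does not vanish near $x$. Define the function $$\xi(z,w)=\frac{1}{A-B}\left[a\left(\frac{b}{a}B\right)_z-b\left(\frac{a}{b}A\right)_w\right].$$ Then $\eta$ is closed at $x$ if and only if the following two conditions are satisfied near $x$: $$\left(\frac{\xi}{a}\right)_z=A,\qquad \left(\frac{\xi}{b}\right)_w=B.$$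
   Context: A complex surface is a smooth complex manifold of dimension $2$. A symmetric $n$-differential on $X$ is a holomorphic section of $S^n(\Omega^1_X)$, the $n$-th symmetric power of the holomorphic cotangent bundle; products of $1$-forms such as $dz\,dw$ without a wedge sign are symmetric products. At each point $x$ of a surface, a symmetric $n$-differential gives a homogeneous polynomial of degree $n$ on $T_xX$, which factors into linear terms. It is called non-degenerate at $x$ if it determines $n$ distinct lines in $T_xX$ (for $n=3$: near $x$ one can write $\eta=\zeta_1\zeta_2\zeta_3$ with holomorphic $1$-forms $\zeta_i$ satisfying $\zeta_i\wedge\zeta_j\neq 0$ at every point for $i\ne j$), and non-degenerate if it is non-degenerate at every point of $X$. A symmetric $n$-differential $\eta$ on a complex surface is called closed at $x$ if in some neighborhood of $x$ there exist closed holomorphic $1$-forms $\zeta_1,\dots,\zeta_n$ with $\eta=\zeta_1\cdots\zeta_n$ (symmetric product). Subscripts $z,w$ denote partial derivatives. $\partial_z\partial_w\log a$ is computed with any local branch of the logarithm, i.e. it equals $(a_w/a)_z$. *)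

theory Defs
  imports "HOL-Analysis.Analysis"
begin

section \<open>Holomorphic functions of two variables\<close>

definition complex_differentiable2 :: "(complex \<times> complex \<Rightarrow> complex) \<Rightarrow> complex \<times> complex \<Rightarrow> bool" where
  "complex_differentiable2 f p \<longleftrightarrow>
     (\<exists>c d. (f has_derivative (\<lambda>h. c * fst h + d * snd h)) (at p))"

text \<open>The derivative is taken at \<open>p\<close> without restriction to \<open>S\<close>; the set \<open>S\<close> is always open below.\<close>
definition holomorphic2_on :: "(complex \<times> complex \<Rightarrow> complex) \<Rightarrow> (complex \<times> complex) set \<Rightarrow> bool" where
  "holomorphic2_on f S \<longleftrightarrow> (\<forall>p\<in>S. complex_differentiable2 f p)"

definition partial_z :: "(complex \<times> complex \<Rightarrow> complex) \<Rightarrow> complex \<times> complex \<Rightarrow> complex" where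
  "partial_z f p = deriv (\<lambda>t. f (t, snd p)) (fst p)"

definition partial_w :: "(complex \<times> complex \<Rightarrow> complex) \<Rightarrow> complex \<times> complex \<Rightarrow> complex" where
  "partial_w f p = deriv (\<lambda>t. f (fst p, t)) (snd p)"

section \<open>Complex surfaces\<close>

text \<open>A chart is a pair \<open>(U, \<phi>)\<close>; the values of \<open>\<phi>\<close> outside \<open>U\<close> are irrelevant.\<close>
type_synonym 'a chart = "'a set \<times> ('a \<Rightarrow> complex \<times> complex)"

definition is_chart :: "'a topology \<Rightarrow> 'a chart \<Rightarrow> bool" where
  "is_chart X = (\<lambda>(U, \<phi>). openin X U \<and> open (\<phi> ` U) \<and>
     homeomorphic_map (subtopology X U) (top_of_set (\<phi> ` U)) \<phi>)"

definition transition :: "'a chart \<Rightarrow> 'a chart \<Rightarrow> complex \<times> complex \<Rightarrow> complex \<times> complex" where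
  "transition c c' = snd c' \<circ> inv_into (fst c) (snd c)"

definition holomorphic_transition :: "'a chart \<Rightarrow> 'a chart \<Rightarrow> bool" where
  "holomorphic_transition c c' \<longleftrightarrow>
     holomorphic2_on (fst \<circ> transition c c') (snd c ` (fst c \<inter> fst c')) \<and>
     holomorphic2_on (snd \<circ> transition c c') (snd c ` (fst c \<inter> fst c'))"

definition compatible_charts :: "'a chart \<Rightarrow> 'a chart \<Rightarrow> bool" where
  "compatible_charts c c' \<longleftrightarrow> holomorphic_transition c c' \<and> holomorphic_transition c' c"

definition complex_surface :: "'a topology \<Rightarrow> 'a chart set \<Rightarrow> bool" where
  "complex_surface X \<A> \<longleftrightarrow>
     Hausdorff_space X \<and> second_countable X \<and>
     (\<forall>c\<in>\<A>. is_chart X c) \<and> (\<Union>c\<in>\<A>. fst c) = topspace X \<and>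
     (\<forall>c\<in>\<A>. \<forall>c'\<in>\<A>. compatible_charts c c')"

text \<open>The maximal atlas generated by \<open>\<A>\<close>: its members are the local holomorphic coordinate systems.\<close>
definition holomorphic_charts :: "'a topology \<Rightarrow> 'a chart set \<Rightarrow> 'a chart set" where
  "holomorphic_charts X \<A> = {c. is_chart X c \<and> (\<forall>c'\<in>\<A>. compatible_charts c c')}"

section \<open>Tangent spaces\<close>

text \<open>A tangent vector at \<open>x\<close> is the family of its components in all holomorphic charts around
  \<open>x\<close>, related by the Jacobians of the transition maps. The value at every other chart is fixed
  to be \<open>0\<close>, so that equality of families is equality of tangent vectors.\<close>
type_synonym 'a tangent = "'a chart \<Rightarrow> complex \<times> complex"

definition charts_at :: "'a topology \<Rightarrow> 'a chart set \<Rightarrow> 'a \<Rightarrow> 'a chart set" where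
  "charts_at X \<A> x = {c \<in> holomorphic_charts X \<A>. x \<in> fst c}"

definition tangent_space :: "'a topology \<Rightarrow> 'a chart set \<Rightarrow> 'a \<Rightarrow> 'a tangent set" where
  "tangent_space X \<A> x = {v.
     (\<forall>c\<in>charts_at X \<A> x. \<forall>c'\<in>charts_at X \<A> x.
        v c' = frechet_derivative (transition c c') (at (snd c x)) (v c)) \<and>
     (\<forall>c. c \<notin> charts_at X \<A> x \<longrightarrow> v c = 0)}"

definition tangent_scale :: "complex \<Rightarrow> 'a tangent \<Rightarrow> 'a tangent" where
  "tangent_scale t v = (\<lambda>c. (t * fst (v c), t * snd (v c)))"

definition tangent_lines :: "'a topology \<Rightarrow> 'a chart set \<Rightarrow> 'a \<Rightarrow> 'a tangent set set" where
  "tangent_lines X \<A> x =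
     {range (\<lambda>t. tangent_scale t v) | v. v \<in> tangent_space X \<A> x \<and> v \<noteq> (\<lambda>_. 0)}"

text \<open>The coordinate differentials \<open>dz\<close> and \<open>dw\<close> of a chart with coordinates \<open>(z, w)\<close>.\<close>
definition coord_dz :: "'a chart \<Rightarrow> 'a tangent \<Rightarrow> complex" where
  "coord_dz c v = fst (v c)"

definition coord_dw :: "'a chart \<Rightarrow> 'a tangent \<Rightarrow> complex" where
  "coord_dw c v = snd (v c)"

section \<open>Symmetric differentials\<close>

text \<open>An element of \<open>S\<^sup>n(T\<^sub>x\<^sup>* X)\<close> is regarded as a homogeneous polynomial of degree \<open>n\<close> on the
  tangent space, so the symmetric product of differentials is the pointwise product of functions.
  Values at points outside \<open>V\<close>, or at families that are not tangent vectors, are irrelevant.\<close>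
type_synonym 'a differential = "'a \<Rightarrow> 'a tangent \<Rightarrow> complex"

definition symmetric_differential_on ::
  "'a topology \<Rightarrow> 'a chart set \<Rightarrow> nat \<Rightarrow> 'a set \<Rightarrow> 'a differential \<Rightarrow> bool" where
  "symmetric_differential_on X \<A> n V \<eta> \<longleftrightarrow>
     (\<forall>c\<in>holomorphic_charts X \<A>. \<exists>f :: nat \<Rightarrow> complex \<times> complex \<Rightarrow> complex.
        (\<forall>i\<le>n. holomorphic2_on (f i) (snd c ` (fst c \<inter> V))) \<and>
        (\<forall>y\<in>fst c \<inter> V. \<forall>v\<in>tangent_space X \<A> y.
           \<eta> y v = (\<Sum>i\<le>n. f i (snd c y) * coord_dz c v ^ i * coord_dw c v ^ (n - i))))"

definition nondegenerate_at ::
  "'a topology \<Rightarrow> 'a chart set \<Rightarrow> nat \<Rightarrow> 'a differential \<Rightarrow> 'a \<Rightarrow> bool" where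
  "nondegenerate_at X \<A> n \<eta> x \<longleftrightarrow>
     finite {L \<in> tangent_lines X \<A> x. \<forall>v\<in>L. \<eta> x v = 0} \<and>
     card {L \<in> tangent_lines X \<A> x. \<forall>v\<in>L. \<eta> x v = 0} = n"

definition nondegenerate ::
  "'a topology \<Rightarrow> 'a chart set \<Rightarrow> nat \<Rightarrow> 'a differential \<Rightarrow> bool" where
  "nondegenerate X \<A> n \<eta> \<longleftrightarrow> (\<forall>x\<in>topspace X. nondegenerate_at X \<A> n \<eta> x)"

text \<open>In coordinates, \<open>d(f dz + g dw) = (g\<^sub>z - f\<^sub>w) dz \<and> dw\<close>.\<close>
definition closed_1form_on ::
  "'a topology \<Rightarrow> 'a chart set \<Rightarrow> 'a set \<Rightarrow> 'a differential \<Rightarrow> bool" where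
  "closed_1form_on X \<A> V \<zeta> \<longleftrightarrow>
     (\<forall>c\<in>holomorphic_charts X \<A>. \<exists>f g.
        holomorphic2_on f (snd c ` (fst c \<inter> V)) \<and>
        holomorphic2_on g (snd c ` (fst c \<inter> V)) \<and>
        (\<forall>y\<in>fst c \<inter> V. \<forall>v\<in>tangent_space X \<A> y.
           \<zeta> y v = f (snd c y) * coord_dz c v + g (snd c y) * coord_dw c v) \<and>
        (\<forall>p\<in>snd c ` (fst c \<inter> V). partial_z g p - partial_w f p = 0))"

definition closed_at ::
  "'a topology \<Rightarrow> 'a chart set \<Rightarrow> nat \<Rightarrow> 'a differential \<Rightarrow> 'a \<Rightarrow> bool" where
  "closed_at X \<A> n \<eta> x \<longleftrightarrow>
     (\<exists>V. openin X V \<and> x \<in> V \<and>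
        (\<exists>\<zeta> :: nat \<Rightarrow> 'a differential.
           (\<forall>i<n. closed_1form_on X \<A> V (\<zeta> i)) \<and>
           (\<forall>y\<in>V. \<forall>v\<in>tangent_space X \<A> y. \<eta> y v = (\<Prod>i<n. \<zeta> i y v))))"

end

theory Submission
  imports Defs "HOL-Complex_Analysis.Complex_Analysis"
begin

text \<open>
  Up to order and nowhere vanishing factors, \<open>dz\<close>, \<open>dw\<close> and \<open>a dz + b dw\<close> are the only linear
  factors of \<open>\<eta>\<close>. So \<open>\<eta>\<close> is closed at \<open>x\<close> exactly if there are functions \<open>P\<close>, \<open>Q\<close>, \<open>h\<close> with
  \<open>P Q h = 1\<close> for which \<open>P dz\<close>, \<open>Q dw\<close> and \<open>h (a dz + b dw)\<close> are closed. The first two conditions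
  say that \<open>P\<close> depends on \<open>z\<close> only and \<open>Q\<close> on \<open>w\<close> only; hence \<open>h\<^sub>z/h = \<alpha>\<close> is a function of \<open>z\<close>
  and \<open>h\<^sub>w/h = \<beta>\<close> a function of \<open>w\<close>. The third condition is \<open>(h a)\<^sub>w = (h b)\<^sub>z\<close>, that is,
  \<open>a\<^sub>w + a \<beta> = b\<^sub>z + b \<alpha>\<close>.

  Let \<open>s\<close> be the common value of the two sides. That \<open>\<beta> = s/a - a\<^sub>w/a\<close> does not depend on \<open>z\<close> is
  the equation \<open>(s/a)\<^sub>z = A\<close>, and that \<open>\<alpha> = s/b - b\<^sub>z/b\<close> does not depend on \<open>w\<close> is the equation
  \<open>(s/b)\<^sub>w = B\<close>. So \<open>\<eta>\<close> is closed at \<open>x\<close> if and only if these two equations have a common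
  holomorphic solution \<open>s\<close> near \<open>x\<close> (\<open>xi_equations_of_closed_factors\<close> and
  \<open>closed_factors_of_xi_equations\<close>). Differentiating the second equation along \<open>z\<close> and eliminating
  the derivatives of \<open>s\<close> by the first leaves a linear equation for \<open>s\<close> with coefficient
  \<open>A - B\<close>; where \<open>A \<noteq> B\<close> its only solution is \<open>\<xi>\<close> (\<open>xi_unique\<close>), so the equations need only be
  tested on \<open>\<xi>\<close>.

  Two supporting theories are needed. Holomorphic functions of two variables must have holomorphic
  partial derivatives, and these must commute; this is derived from Cauchy's formula in one variable
  (\<open>sep_holomorphic_partial_z\<close>, \<open>mixed_partials_sep\<close>, \<open>sep_holomorphic_imp_holomorphic2\<close>).
  And the argument in the chart \<open>(U, \<phi>)\<close> must be transported to the surface: closedness of a 1-form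
  is independent of the chart (\<open>closed_1form_onI\<close>), and every pair of components in a
  chart comes from a tangent vector (\<open>tangent_vector_exists\<close>), so that an identity of symmetric
  differentials is an identity of polynomials.
\<close>

section \<open>Partial derivatives of holomorphic functions of two variables\<close>

lemma complex_differentiable2_has_derivative:
  assumes "(f has_derivative (\<lambda>h. c * fst h + d * snd h)) (at p)"
  shows "((\<lambda>t. f (t, snd p)) has_field_derivative c) (at (fst p))"
    and "((\<lambda>t. f (fst p, t)) has_field_derivative d) (at (snd p))"
    and "partial_z f p = c" and "partial_w f p = d"
proof -
  have *: "(f has_derivative (\<lambda>h. c * fst h + d * snd h)) (at (fst p, snd p))"
    using assms by simp
  show 1: "((\<lambda>t. f (t, snd p)) has_field_derivative c) (at (fst p))"
    unfolding has_field_derivative_def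
    by (rule has_derivative_eq_rhs[OF has_derivative_compose[of "\<lambda>t. (t, snd p)", OF _ *]])
      (auto intro!: derivative_eq_intros)
  show 2: "((\<lambda>t. f (fst p, t)) has_field_derivative d) (at (snd p))"
    unfolding has_field_derivative_def
    by (rule has_derivative_eq_rhs[OF has_derivative_compose[of "\<lambda>t. (fst p, t)", OF _ *]])
      (auto intro!: derivative_eq_intros)
  show "partial_z f p = c" "partial_w f p = d"
    unfolding partial_z_def partial_w_def using 1 2 by (auto intro: DERIV_imp_deriv)
qed

lemma has_derivative_partials:
  assumes "complex_differentiable2 f p"
  shows "(f has_derivative (\<lambda>h. partial_z f p * fst h + partial_w f p * snd h)) (at p)"
  using assms complex_differentiable2_has_derivative(3,4) unfolding complex_differentiable2_def
  by metis

lemma partial_z_DERIV: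
  assumes "complex_differentiable2 f p"
  shows "((\<lambda>t. f (t, snd p)) has_field_derivative partial_z f p) (at (fst p))"
  by (rule complex_differentiable2_has_derivative(1)[OF has_derivative_partials[OF assms]])

lemma partial_w_DERIV:
  assumes "complex_differentiable2 f p"
  shows "((\<lambda>t. f (fst p, t)) has_field_derivative partial_w f p) (at (snd p))"
  by (rule complex_differentiable2_has_derivative(2)[OF has_derivative_partials[OF assms]])

text \<open>Continuity with holomorphy in each variable separately is the notion that survives passing to a
  partial derivative by way of the Cauchy integral; joint differentiability is recovered from it in
  \<open>sep_holomorphic_imp_holomorphic2\<close>.\<close>

definition sep_holomorphic_on ::
  "(complex \<times> complex \<Rightarrow> complex) \<Rightarrow> (complex \<times> complex) set \<Rightarrow> bool" where
  "sep_holomorphic_on f S \<longleftrightarrow> continuous_on S f \<and>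
     (\<forall>p\<in>S. (\<lambda>t. f (t, snd p)) field_differentiable at (fst p)) \<and>
     (\<forall>p\<in>S. (\<lambda>t. f (fst p, t)) field_differentiable at (snd p))"

lemma holomorphic2_on_imp_sep:
  assumes "holomorphic2_on f S"
  shows "sep_holomorphic_on f S"
  unfolding sep_holomorphic_on_def
proof (intro conjI ballI)
  show "continuous_on S f"
    using assms unfolding holomorphic2_on_def complex_differentiable2_def
    by (meson continuous_at_imp_continuous_on has_derivative_continuous)
next
  fix p assume "p \<in> S"
  then have d: "complex_differentiable2 f p" using assms by (auto simp: holomorphic2_on_def)
  show "(\<lambda>t. f (t, snd p)) field_differentiable at (fst p)"
    using partial_z_DERIV[OF d] field_differentiable_def by blast
  show "(\<lambda>t. f (fst p, t)) field_differentiable at (snd p)"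
    using partial_w_DERIV[OF d] field_differentiable_def by blast
qed

lemma open_contains_bidisc:
  fixes S :: "(complex \<times> complex) set"
  assumes "open S" "p \<in> S"
  obtains r where "r > 0" "cball (fst p) r \<times> cball (snd p) r \<subseteq> S"
proof -
  obtain A B where AB: "open A" "open B" "p \<in> A \<times> B" "A \<times> B \<subseteq> S"
    using assms open_prod_elim by metis
  obtain r1 r2 where "r1 > 0" "cball (fst p) r1 \<subseteq> A" "r2 > 0" "cball (snd p) r2 \<subseteq> B"
    using AB open_contains_cball by (metis mem_Times_iff)
  then show thesis
    using AB by (intro that[of "min r1 r2"]) (auto simp: subset_iff)
qed

text \<open>This is \<open>\<gamma>'(t) / (2 \<pi> \<i> (\<gamma>(t) - z)\<^sup>2)\<close> for the circle \<open>\<gamma>\<close> of radius \<open>r\<close> around \<open>z0\<close>. Writing the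
  Cauchy integral over the real interval \<open>[0, 1]\<close> makes the theorems on integrals with a parameter
  applicable.\<close>

definition cauchy_kernel :: "complex \<Rightarrow> real \<Rightarrow> complex \<Rightarrow> real \<Rightarrow> complex" where
  "cauchy_kernel z0 r z t =
     of_real r * exp (2 * of_real pi * \<i> * of_real t) / (circlepath z0 r t - z)\<^sup>2"

lemma circlepath_in_cball: "r \<ge> 0 \<Longrightarrow> circlepath z0 r t \<in> cball z0 r"
  by (simp add: circlepath dist_norm norm_mult)

lemma circlepath_ne: "z \<in> ball z0 r \<Longrightarrow> circlepath z0 r t - z \<noteq> 0"
  by (auto simp: circlepath dist_norm norm_mult)

lemma continuous_on_cauchy_kernel [continuous_intros]:
  assumes "continuous_on T g" "continuous_on T h" "\<And>x. x \<in> T \<Longrightarrow> h x \<in> ball z0 r"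
  shows "continuous_on T (\<lambda>x. cauchy_kernel z0 r (h x) (g x))"
  unfolding cauchy_kernel_def
  by (intro continuous_intros assms) (use assms(3) circlepath_ne in \<open>auto simp: circlepath intro!: continuous_intros assms\<close>)

text \<open>Only values of \<open>f\<close> enter on the right, and only on a circle that is fixed while \<open>(z, w)\<close> varies.
  All regularity of \<open>partial_z f\<close> comes from this.\<close>

lemma partial_z_cauchy_integral:
  assumes "open S" "cball z0 r \<times> cball w0 r \<subseteq> S" "continuous_on S f"
    and fz: "\<And>p. p \<in> S \<Longrightarrow> (\<lambda>t. f (t, snd p)) field_differentiable at (fst p)"
    and "z \<in> ball z0 r" "w \<in> cball w0 r"
  shows "partial_z f (z, w) = integral {0..1} (\<lambda>t. f (circlepath z0 r t, w) * cauchy_kernel z0 r z t)"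
proof -
  have d: "(\<lambda>t. f (t, w)) field_differentiable at u" if "u \<in> cball z0 r" for u
  proof -
    have "(u, w) \<in> S" using that assms(2,6) by blast
    then show ?thesis using fz[of "(u, w)"] by simp
  qed
  have hol: "(\<lambda>t. f (t, w)) holomorphic_on cball z0 r"
    unfolding holomorphic_on_def using d field_differentiable_at_within by blast
  have "contour_integral (circlepath z0 r) (\<lambda>u. f (u, w) / (u - z)\<^sup>2) = (2 * pi * \<i>) * partial_z f (z, w)"
    using Cauchy_contour_integral_circlepath_2[OF holomorphic_on_imp_continuous_on[OF hol]
        holomorphic_on_subset[OF hol ball_subset_cball] assms(5)]
    by (simp add: partial_z_def)
  moreover have "contour_integral (circlepath z0 r) (\<lambda>u. f (u, w) / (u - z)\<^sup>2)
     = integral {0..1} (\<lambda>t. (2 * pi * \<i>) * (f (circlepath z0 r t, w) * cauchy_kernel z0 r z t))"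
    unfolding contour_integral_integral
    by (intro integral_cong) (simp add: vector_derivative_circlepath cauchy_kernel_def)
  ultimately show ?thesis by simp
qed

lemma continuous_on_compose_pair:
  fixes f :: "complex \<times> complex \<Rightarrow> complex"
  assumes "continuous_on S f" "continuous_on T g" "continuous_on T h"
    "\<And>x. x \<in> T \<Longrightarrow> (g x, h x) \<in> S"
  shows "continuous_on T (\<lambda>x. f (g x, h x))"
  by (rule continuous_on_compose2[OF assms(1)]) (use assms in \<open>auto intro!: continuous_intros\<close>)

lemma continuous_on_partial_z:
  assumes "open S" "continuous_on S f"
    and fz: "\<And>p. p \<in> S \<Longrightarrow> (\<lambda>t. f (t, snd p)) field_differentiable at (fst p)"
  shows "continuous_on S (partial_z f)"
proof (rule continuous_at_imp_continuous_on, rule ballI)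
  fix p assume "p \<in> S"
  then obtain r where r: "r > 0" "cball (fst p) r \<times> cball (snd p) r \<subseteq> S"
    using open_contains_bidisc assms by blast
  define U where "U = ball (fst p) r \<times> ball (snd p) r"
  have "continuous_on U (\<lambda>q. integral (cbox 0 1)
      (\<lambda>t. f (circlepath (fst p) r t, snd q) * cauchy_kernel (fst p) r (fst q) t))"
  proof (rule integral_continuous_on_param)
    have 1: "continuous_on (U \<times> cbox 0 1) (\<lambda>x. circlepath (fst p) r (snd x))"
      by (auto simp: circlepath intro!: continuous_intros)
    have "(circlepath (fst p) r (snd x), snd (fst x)) \<in> S" if "x \<in> U \<times> cbox 0 1" for x
      using that r circlepath_in_cball[of r "fst p"] by (auto simp: U_def subset_iff)
    then show "continuous_on (U \<times> cbox 0 1)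
      (\<lambda>(q, t). f (circlepath (fst p) r t, snd q) * cauchy_kernel (fst p) r (fst q) t)"
      unfolding split_beta
      by (intro continuous_intros continuous_on_compose_pair[OF assms(2)] 1) (auto simp: U_def)
  qed
  then have "continuous_on U (partial_z f)"
    by (rule continuous_on_eq)
      (use partial_z_cauchy_integral[OF assms(1) r(2) assms(2) fz] in \<open>auto simp: U_def\<close>)
  moreover have "open U" "p \<in> U"
    using r(1) by (auto simp: U_def open_Times mem_Times_iff)
  ultimately show "isCont (partial_z f) p"
    by (simp add: continuous_on_eq_continuous_at)
qed

text \<open>Statements on \<open>partial_w\<close> follow from those on \<open>partial_z\<close> by exchanging the variables.\<close>

lemma partial_z_swap: "partial_z (f \<circ> prod.swap) p = partial_w f (prod.swap p)"
  by (simp add: partial_z_def partial_w_def prod.swap_def)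

lemma sep_holomorphic_on_swap:
  assumes "sep_holomorphic_on f S"
  shows "sep_holomorphic_on (f \<circ> prod.swap) (prod.swap ` S)"
proof -
  have "continuous_on (prod.swap ` S) (f \<circ> prod.swap)"
    using assms unfolding sep_holomorphic_on_def
    by (intro continuous_on_compose continuous_on_swap) (auto simp: image_image)
  then show ?thesis
    using assms by (auto simp: sep_holomorphic_on_def)
qed

lemma open_swap_image:
  fixes S :: "('a::topological_space \<times> 'b::topological_space) set"
  assumes "open S" shows "open (prod.swap ` S)"
proof -
  have "prod.swap ` S = prod.swap -` S" by force
  then show ?thesis using open_vimage[OF assms continuous_on_swap] by simp
qed

lemma sep_continuous_partials:
  assumes "open S" "sep_holomorphic_on f S"
  shows "continuous_on S (partial_z f)" "continuous_on S (partial_w f)"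
proof -
  show "continuous_on S (partial_z f)"
    using assms continuous_on_partial_z unfolding sep_holomorphic_on_def by blast
  have "sep_holomorphic_on (f \<circ> prod.swap) (prod.swap ` S)" "open (prod.swap ` S)"
    using assms by (auto intro: sep_holomorphic_on_swap open_swap_image)
  then have "continuous_on (prod.swap ` S) (partial_z (f \<circ> prod.swap))"
    using continuous_on_partial_z unfolding sep_holomorphic_on_def by blast
  then have "continuous_on S (partial_z (f \<circ> prod.swap) \<circ> prod.swap)"
    by (intro continuous_on_compose continuous_on_swap)
  moreover have "partial_z (f \<circ> prod.swap) \<circ> prod.swap = partial_w f"
    by (auto simp: fun_eq_iff partial_z_swap)
  ultimately show "continuous_on S (partial_w f)" by simp
qed

text \<open>Differentiation under the Cauchy integral. The derivative is left as an integral: to read it as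
  \<open>partial_z (partial_w f)\<close> one must know that \<open>partial_w f\<close> is holomorphic in \<open>z\<close>, which is
  this lemma with the variables exchanged.\<close>

lemma partial_z_DERIV_w:
  assumes "open S" "sep_holomorphic_on f S" "cball z0 r \<times> cball w0 r \<subseteq> S" "z \<in> ball z0 r" "w \<in> ball w0 r"
  shows "((\<lambda>s. partial_z f (z, s)) has_field_derivative
     integral {0..1} (\<lambda>t. partial_w f (circlepath z0 r t, w) * cauchy_kernel z0 r z t)) (at w)"
proof -
  have r: "r > 0" using assms(4) by (auto intro: le_less_trans[OF zero_le_dist])
  have f: "continuous_on S f" "\<And>p. p \<in> S \<Longrightarrow> (\<lambda>t. f (t, snd p)) field_differentiable at (fst p)"
    using assms(2) by (auto simp: sep_holomorphic_on_def)
  have circ: "(circlepath z0 r t, s) \<in> S" if "s \<in> ball w0 r" for t s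
    using that assms(3) circlepath_in_cball[of r z0] r by (auto simp: subset_iff)
  have c1: "continuous_on T (\<lambda>x. circlepath z0 r (g x))" if "continuous_on T g" for T :: "'b::topological_space set" and g
    using that by (auto simp: circlepath intro!: continuous_intros)
  have "((\<lambda>s. integral (cbox 0 1) (\<lambda>t. f (circlepath z0 r t, s) * cauchy_kernel z0 r z t)) has_field_derivative
     integral (cbox 0 1) (\<lambda>t. partial_w f (circlepath z0 r t, w) * cauchy_kernel z0 r z t)) (at w within ball w0 r)"
  proof (rule leibniz_rule_field_derivative)
    fix s and t :: real assume s: "s \<in> ball w0 r"
    have "(\<lambda>s. f (circlepath z0 r t, s)) field_differentiable at s"
      using assms(2) circ[OF s] unfolding sep_holomorphic_on_def by fastforce
    then have "((\<lambda>s. f (circlepath z0 r t, s)) has_field_derivative partial_w f (circlepath z0 r t, s)) (at s)"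
      by (simp add: partial_w_def DERIV_deriv_iff_field_differentiable)
    then show "((\<lambda>s. f (circlepath z0 r t, s) * cauchy_kernel z0 r z t) has_field_derivative
        partial_w f (circlepath z0 r t, s) * cauchy_kernel z0 r z t) (at s within ball w0 r)"
      by (rule has_field_derivative_at_within[OF DERIV_cmult_right])
  next
    fix s assume s: "s \<in> ball w0 r"
    have "continuous_on (cbox 0 1) (\<lambda>t. f (circlepath z0 r t, s) * cauchy_kernel z0 r z t)"
      by (intro continuous_intros continuous_on_compose_pair[OF f(1)] c1) (use circ[OF s] assms in auto)
    then show "(\<lambda>t. f (circlepath z0 r t, s) * cauchy_kernel z0 r z t) integrable_on cbox 0 1"
      by (rule integrable_continuous)
  next
    show "continuous_on (ball w0 r \<times> cbox 0 1) (\<lambda>(s, t). partial_w f (circlepath z0 r t, s) * cauchy_kernel z0 r z t)"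
      unfolding split_beta
      by (intro continuous_intros continuous_on_compose_pair[OF sep_continuous_partials(2)[OF assms(1,2)]] c1)
        (use circ assms in auto)
  qed (use assms in auto)
  then have D: "((\<lambda>s. integral {0..1} (\<lambda>t. f (circlepath z0 r t, s) * cauchy_kernel z0 r z t)) has_field_derivative
     integral {0..1} (\<lambda>t. partial_w f (circlepath z0 r t, w) * cauchy_kernel z0 r z t)) (at w)"
    using assms(5) by (simp add: at_within_open[of w "ball w0 r"])
  show ?thesis
    by (rule has_field_derivative_transform_within_open[OF D open_ball assms(5)])
      (use partial_z_cauchy_integral[OF assms(1,3) f assms(4)] in auto)
qed

lemma sep_holomorphic_partial_z:
  assumes "open S" "sep_holomorphic_on f S"
  shows "sep_holomorphic_on (partial_z f) S"
  unfolding sep_holomorphic_on_def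
proof (intro conjI ballI)
  show "continuous_on S (partial_z f)"
    using sep_continuous_partials assms by blast
next
  fix p assume "p \<in> S"
  then obtain r where r: "r > 0" "cball (fst p) r \<times> cball (snd p) r \<subseteq> S"
    using open_contains_bidisc assms by blast
  show "(\<lambda>t. partial_z f (fst p, t)) field_differentiable at (snd p)"
    using partial_z_DERIV_w[OF assms r(2), of "fst p" "snd p"] r(1) field_differentiable_def by auto
  have "(\<lambda>t. f (t, snd p)) holomorphic_on ball (fst p) r"
    unfolding holomorphic_on_def
  proof
    fix u assume "u \<in> ball (fst p) r"
    then have "(u, snd p) \<in> S" using r by (auto simp: subset_iff)
    then show "(\<lambda>t. f (t, snd p)) field_differentiable at u within ball (fst p) r"
      using assms(2) field_differentiable_at_within unfolding sep_holomorphic_on_def by fastforce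
  qed
  then have "deriv (\<lambda>t. f (t, snd p)) holomorphic_on ball (fst p) r"
    by (rule holomorphic_deriv) simp
  then have "deriv (\<lambda>t. f (t, snd p)) field_differentiable at (fst p)"
    using r(1) by (intro holomorphic_on_imp_differentiable_at[of _ "ball (fst p) r"]) auto
  then show "(\<lambda>t. partial_z f (t, snd p)) field_differentiable at (fst p)"
    by (simp add: partial_z_def)
qed

lemma sep_holomorphic_partial_w:
  assumes "open S" "sep_holomorphic_on f S"
  shows "sep_holomorphic_on (partial_w f) S"
proof -
  have "sep_holomorphic_on (partial_z (f \<circ> prod.swap)) (prod.swap ` S)"
    using assms by (intro sep_holomorphic_partial_z sep_holomorphic_on_swap open_swap_image)
  then have "sep_holomorphic_on (partial_z (f \<circ> prod.swap) \<circ> prod.swap) (prod.swap ` prod.swap ` S)"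
    by (rule sep_holomorphic_on_swap)
  moreover have "partial_z (f \<circ> prod.swap) \<circ> prod.swap = partial_w f"
    by (auto simp: fun_eq_iff partial_z_swap)
  ultimately show ?thesis by (simp add: image_image)
qed

text \<open>The integral in \<open>partial_z_DERIV_w\<close> is the Cauchy formula for the \<open>z\<close>-derivative of
  \<open>partial_w f\<close>.\<close>

lemma mixed_partials_sep:
  assumes "open S" "sep_holomorphic_on f S" "p \<in> S"
  shows "partial_w (partial_z f) p = partial_z (partial_w f) p"
proof -
  obtain r where r: "r > 0" "cball (fst p) r \<times> cball (snd p) r \<subseteq> S"
    using open_contains_bidisc assms by blast
  have w: "continuous_on S (partial_w f)"
     "\<And>p. p \<in> S \<Longrightarrow> (\<lambda>t. partial_w f (t, snd p)) field_differentiable at (fst p)"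
    using sep_holomorphic_partial_w[OF assms(1,2)] by (auto simp: sep_holomorphic_on_def)
  have "partial_w (partial_z f) p =
      integral {0..1} (\<lambda>t. partial_w f (circlepath (fst p) r t, snd p) * cauchy_kernel (fst p) r (fst p) t)"
    unfolding partial_w_def[of "partial_z f"]
    by (rule DERIV_imp_deriv partial_z_DERIV_w assms r(2))+ (use r in auto)
  also have "\<dots> = partial_z (partial_w f) (fst p, snd p)"
    by (rule partial_z_cauchy_integral[OF assms(1) r(2) w, symmetric]) (use r in auto)
  finally show ?thesis by simp
qed

text \<open>Osgood's lemma: the partial derivatives are continuous, and continuous partial derivatives give
  a total derivative.\<close>

lemma sep_holomorphic_imp_holomorphic2:
  assumes "open S" "sep_holomorphic_on f S"
  shows "holomorphic2_on f S"
  unfolding holomorphic2_on_def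
proof
  fix p assume p: "p \<in> S"
  then obtain r where r: "r > 0" "cball (fst p) r \<times> cball (snd p) r \<subseteq> S"
    using open_contains_bidisc assms by blast
  let ?U = "ball (fst p) r" and ?V = "ball (snd p) r"
  have sub: "?U \<times> ?V \<subseteq> S" using r by (auto simp: subset_iff)
  have "((\<lambda>(x, y). f (x, y)) has_derivative (\<lambda>(tx, ty). partial_z f p * tx + blinfun_mult_right (partial_w f (fst p, snd p)) ty))
     (at (fst p, snd p) within ?U \<times> ?V)"
  proof (rule has_derivative_partialsI)
    show "((\<lambda>x. f (x, snd p)) has_derivative (*) (partial_z f p)) (at (fst p) within ?U)"
      using assms(2) p unfolding sep_holomorphic_on_def partial_z_def has_field_derivative_def[symmetric]
      by (auto simp: DERIV_deriv_iff_field_differentiable intro: has_field_derivative_at_within)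
    fix x y assume "x \<in> ?U" "y \<in> ?V"
    then have "(x, y) \<in> S" using sub by auto
    then have "((\<lambda>y. f (x, y)) has_field_derivative partial_w f (x, y)) (at y)"
      using assms(2) unfolding sep_holomorphic_on_def partial_w_def
      by (fastforce simp: DERIV_deriv_iff_field_differentiable)
    then show "((\<lambda>y. f (x, y)) has_derivative blinfun_apply (blinfun_mult_right (partial_w f (x, y)))) (at y within ?V)"
      by (simp add: has_field_derivative_def blinfun_mult_right.rep_eq has_derivative_at_withinI)
  next
    have "isCont (partial_w f) p"
      using sep_continuous_partials(2)[OF assms] p assms(1) by (simp add: continuous_on_eq_continuous_at)
    then have "continuous (at p within ?U \<times> ?V) (\<lambda>q. blinfun_mult_right (partial_w f q))"
      by (intro continuous_intros bounded_linear.continuous[OF bounded_linear_blinfun_mult_right])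
        (auto intro: continuous_at_imp_continuous_at_within)
    then show "continuous (at (fst p, snd p) within ?U \<times> ?V) (\<lambda>(x, y). blinfun_mult_right (partial_w f (x, y)))"
      by (simp add: case_prod_unfold)
  qed (use r in auto)
  then have "(f has_derivative (\<lambda>h. partial_z f p * fst h + partial_w f p * snd h)) (at p within ?U \<times> ?V)"
    by (simp add: case_prod_unfold blinfun_mult_right.rep_eq)
  moreover have "at p within ?U \<times> ?V = at p"
    using r(1) by (intro at_within_open) (auto simp: open_Times mem_Times_iff)
  ultimately show "complex_differentiable2 f p"
    unfolding complex_differentiable2_def by auto
qed

lemma holomorphic2_on_partial_z:
  "open S \<Longrightarrow> holomorphic2_on f S \<Longrightarrow> holomorphic2_on (partial_z f) S"
  by (meson holomorphic2_on_imp_sep sep_holomorphic_imp_holomorphic2 sep_holomorphic_partial_z)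

lemma holomorphic2_on_partial_w:
  "open S \<Longrightarrow> holomorphic2_on f S \<Longrightarrow> holomorphic2_on (partial_w f) S"
  by (meson holomorphic2_on_imp_sep sep_holomorphic_imp_holomorphic2 sep_holomorphic_partial_w)

lemma mixed_partials:
  "open S \<Longrightarrow> holomorphic2_on f S \<Longrightarrow> p \<in> S \<Longrightarrow> partial_w (partial_z f) p = partial_z (partial_w f) p"
  by (meson holomorphic2_on_imp_sep mixed_partials_sep)

section \<open>Algebra of holomorphic functions and their derivatives\<close>

named_theorems holomorphic2_intros

lemma complex_differentiable2_const: "complex_differentiable2 (\<lambda>_. k) p"
  unfolding complex_differentiable2_def by (rule exI[of _ 0], rule exI[of _ 0]) simp

lemma complex_differentiable2_diff:
  assumes "complex_differentiable2 f p" "complex_differentiable2 g p"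
  shows "complex_differentiable2 (\<lambda>q. f q - g q) p"
  unfolding complex_differentiable2_def
  by (rule exI[of _ "partial_z f p - partial_z g p"], rule exI[of _ "partial_w f p - partial_w g p"],
      rule has_derivative_eq_rhs[OF has_derivative_diff[OF assms[THEN has_derivative_partials]]])
    (simp add: algebra_simps)

lemma complex_differentiable2_add:
  assumes "complex_differentiable2 f p" "complex_differentiable2 g p"
  shows "complex_differentiable2 (\<lambda>q. f q + g q) p"
  unfolding complex_differentiable2_def
  by (rule exI[of _ "partial_z f p + partial_z g p"], rule exI[of _ "partial_w f p + partial_w g p"],
      rule has_derivative_eq_rhs[OF has_derivative_add[OF assms[THEN has_derivative_partials]]])
    (simp add: algebra_simps)

lemma complex_differentiable2_mult:
  assumes "complex_differentiable2 f p" "complex_differentiable2 g p"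
  shows "complex_differentiable2 (\<lambda>q. f q * g q) p"
  unfolding complex_differentiable2_def
  by (rule exI[of _ "f p * partial_z g p + partial_z f p * g p"],
      rule exI[of _ "f p * partial_w g p + partial_w f p * g p"],
      rule has_derivative_eq_rhs[OF has_derivative_mult[OF assms[THEN has_derivative_partials]]])
    (simp add: algebra_simps)

lemma complex_differentiable2_compose_field:
  assumes "complex_differentiable2 f p" "(g has_field_derivative D) (at (f p))"
  shows "complex_differentiable2 (\<lambda>q. g (f q)) p"
  unfolding complex_differentiable2_def
  by (rule exI[of _ "D * partial_z f p"], rule exI[of _ "D * partial_w f p"],
      rule has_derivative_eq_rhs[OF has_derivative_compose[OF has_derivative_partials[OF assms(1)]
        assms(2)[unfolded has_field_derivative_def]]])
    (simp add: algebra_simps)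

lemma complex_differentiable2_divide:
  assumes "complex_differentiable2 f p" "complex_differentiable2 g p" "g p \<noteq> 0"
  shows "complex_differentiable2 (\<lambda>q. f q / g q) p"
  unfolding divide_inverse
  by (rule complex_differentiable2_mult[OF assms(1) complex_differentiable2_compose_field[OF assms(2)]])
    (rule DERIV_inverse[OF assms(3)])

lemma complex_differentiable2_fst: "complex_differentiable2 fst p"
  unfolding complex_differentiable2_def by (rule exI[of _ 1], rule exI[of _ 0]) (auto intro!: derivative_eq_intros)

lemma complex_differentiable2_snd: "complex_differentiable2 snd p"
  unfolding complex_differentiable2_def by (rule exI[of _ 0], rule exI[of _ 1]) (auto intro!: derivative_eq_intros)

lemma holomorphic2_on_const [holomorphic2_intros]: "holomorphic2_on (\<lambda>_. k) S"
  by (auto simp: holomorphic2_on_def intro: complex_differentiable2_const)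

lemma holomorphic2_on_diff [holomorphic2_intros]:
  "holomorphic2_on f S \<Longrightarrow> holomorphic2_on g S \<Longrightarrow> holomorphic2_on (\<lambda>q. f q - g q) S"
  by (auto simp: holomorphic2_on_def intro: complex_differentiable2_diff)

lemma holomorphic2_on_add [holomorphic2_intros]:
  "holomorphic2_on f S \<Longrightarrow> holomorphic2_on g S \<Longrightarrow> holomorphic2_on (\<lambda>q. f q + g q) S"
  by (auto simp: holomorphic2_on_def intro: complex_differentiable2_add)

lemma holomorphic2_on_mult [holomorphic2_intros]:
  "holomorphic2_on f S \<Longrightarrow> holomorphic2_on g S \<Longrightarrow> holomorphic2_on (\<lambda>q. f q * g q) S"
  by (auto simp: holomorphic2_on_def intro: complex_differentiable2_mult)

lemma holomorphic2_on_divide [holomorphic2_intros]: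
  "holomorphic2_on f S \<Longrightarrow> holomorphic2_on g S \<Longrightarrow> \<forall>p\<in>S. g p \<noteq> 0 \<Longrightarrow> holomorphic2_on (\<lambda>q. f q / g q) S"
  by (auto simp: holomorphic2_on_def intro: complex_differentiable2_divide)

declare holomorphic2_on_partial_z [holomorphic2_intros] holomorphic2_on_partial_w [holomorphic2_intros]

lemma holomorphic2_on_subset: "holomorphic2_on f S \<Longrightarrow> T \<subseteq> S \<Longrightarrow> holomorphic2_on f T"
  by (auto simp: holomorphic2_on_def)

lemma complex_differentiable2_cong:
  assumes "open S" "p \<in> S" "\<And>q. q \<in> S \<Longrightarrow> f q = g q"
  shows "complex_differentiable2 f p \<longleftrightarrow> complex_differentiable2 g p"
proof -
  have "(f has_derivative D) (at p) \<longleftrightarrow> (g has_derivative D) (at p)" for D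
    using has_derivative_transform_within_open[OF _ assms(1,2), of f D UNIV g]
      has_derivative_transform_within_open[OF _ assms(1,2), of g D UNIV f] assms(3) by auto
  then show ?thesis by (simp add: complex_differentiable2_def)
qed

lemma partial_z_cong:
  assumes "open S" "p \<in> S" "\<And>q. q \<in> S \<Longrightarrow> f q = g q"
  shows "partial_z f p = partial_z g p"
  unfolding partial_z_def
proof (rule deriv_cong_ev)
  have "((\<lambda>t. (t, snd p)) \<longlongrightarrow> (fst p, snd p)) (nhds (fst p))"
    by (rule tendsto_Pair[OF filterlim_ident tendsto_const])
  from topological_tendstoD[OF this assms(1)] assms(2)
  have "\<forall>\<^sub>F t in nhds (fst p). (t, snd p) \<in> S" by simp
  then show "\<forall>\<^sub>F t in nhds (fst p). f (t, snd p) = g (t, snd p)"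
    by eventually_elim (rule assms(3))
qed simp

lemma partial_w_cong:
  assumes "open S" "p \<in> S" "\<And>q. q \<in> S \<Longrightarrow> f q = g q"
  shows "partial_w f p = partial_w g p"
  unfolding partial_w_def
proof (rule deriv_cong_ev)
  have "((\<lambda>t. (fst p, t)) \<longlongrightarrow> (fst p, snd p)) (nhds (snd p))"
    by (rule tendsto_Pair[OF tendsto_const filterlim_ident])
  from topological_tendstoD[OF this assms(1)] assms(2)
  have "\<forall>\<^sub>F t in nhds (snd p). (fst p, t) \<in> S" by simp
  then show "\<forall>\<^sub>F t in nhds (snd p). f (fst p, t) = g (fst p, t)"
    by eventually_elim (rule assms(3))
qed simp

lemma partial_const [simp]: "partial_z (\<lambda>_. k) p = 0" "partial_w (\<lambda>_. k) p = 0"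
  by (simp_all add: partial_z_def partial_w_def)

lemma partial_add:
  assumes "complex_differentiable2 f p" "complex_differentiable2 g p"
  shows "partial_z (\<lambda>q. f q + g q) p = partial_z f p + partial_z g p"
    and "partial_w (\<lambda>q. f q + g q) p = partial_w f p + partial_w g p"
  using DERIV_imp_deriv[OF DERIV_add[OF assms[THEN partial_z_DERIV]]]
    DERIV_imp_deriv[OF DERIV_add[OF assms[THEN partial_w_DERIV]]]
  by (simp_all add: partial_z_def partial_w_def)

lemma partial_diff:
  assumes "complex_differentiable2 f p" "complex_differentiable2 g p"
  shows "partial_z (\<lambda>q. f q - g q) p = partial_z f p - partial_z g p"
    and "partial_w (\<lambda>q. f q - g q) p = partial_w f p - partial_w g p"
  using DERIV_imp_deriv[OF DERIV_diff[OF assms[THEN partial_z_DERIV]]]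
    DERIV_imp_deriv[OF DERIV_diff[OF assms[THEN partial_w_DERIV]]]
  by (simp_all add: partial_z_def partial_w_def)

lemma partial_mult:
  assumes "complex_differentiable2 f p" "complex_differentiable2 g p"
  shows "partial_z (\<lambda>q. f q * g q) p = partial_z f p * g p + f p * partial_z g p"
    and "partial_w (\<lambda>q. f q * g q) p = partial_w f p * g p + f p * partial_w g p"
  using DERIV_imp_deriv[OF DERIV_mult[OF assms[THEN partial_z_DERIV]]]
    DERIV_imp_deriv[OF DERIV_mult[OF assms[THEN partial_w_DERIV]]]
  by (simp_all add: partial_z_def partial_w_def mult_ac)

lemma partial_divide:
  assumes "complex_differentiable2 f p" "complex_differentiable2 g p" "g p \<noteq> 0"
  shows "partial_z (\<lambda>q. f q / g q) p = (partial_z f p * g p - f p * partial_z g p) / (g p * g p)"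
    and "partial_w (\<lambda>q. f q / g q) p = (partial_w f p * g p - f p * partial_w g p) / (g p * g p)"
  using DERIV_imp_deriv[OF DERIV_divide[OF assms(1,2)[THEN partial_z_DERIV]]]
    DERIV_imp_deriv[OF DERIV_divide[OF assms(1,2)[THEN partial_w_DERIV]]] assms(3)
  by (simp_all add: partial_z_def partial_w_def)

text \<open>Both sides are the mixed second derivative of \<open>log f\<close>. Hence \<open>B\<close>, which is defined with the
  \<open>w\<close>-derivative inside, is also \<open>(b\<^sub>z/b)\<^sub>w\<close>.\<close>

lemma mixed_partials_log:
  assumes "open S" "holomorphic2_on f S" "\<forall>p\<in>S. f p \<noteq> 0" "p \<in> S"
  shows "partial_w (\<lambda>q. partial_z f q / f q) p = partial_z (\<lambda>q. partial_w f q / f q) p"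
proof -
  have "complex_differentiable2 f p" "complex_differentiable2 (partial_z f) p"
    "complex_differentiable2 (partial_w f) p" "f p \<noteq> 0"
    using assms holomorphic2_on_partial_z[OF assms(1,2)] holomorphic2_on_partial_w[OF assms(1,2)]
    by (auto simp: holomorphic2_on_def)
  then show ?thesis
    by (simp add: partial_divide mixed_partials[OF assms(1,2,4)] mult.commute)
qed

lemma has_derivative_map2:
  assumes "complex_differentiable2 (fst \<circ> T) p" "complex_differentiable2 (snd \<circ> T) p"
  shows "(T has_derivative
      (\<lambda>h. (partial_z (fst \<circ> T) p * fst h + partial_w (fst \<circ> T) p * snd h,
            partial_z (snd \<circ> T) p * fst h + partial_w (snd \<circ> T) p * snd h))) (at p)"
proof -
  have "((\<lambda>q. ((fst \<circ> T) q, (snd \<circ> T) q)) has_derivative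
      (\<lambda>h. (partial_z (fst \<circ> T) p * fst h + partial_w (fst \<circ> T) p * snd h,
            partial_z (snd \<circ> T) p * fst h + partial_w (snd \<circ> T) p * snd h))) (at p)"
    by (intro has_derivative_Pair has_derivative_partials assms)
  then show ?thesis by simp
qed

lemma complex_differentiable2_compose:
  assumes T: "complex_differentiable2 (fst \<circ> T) p" "complex_differentiable2 (snd \<circ> T) p"
    and f: "complex_differentiable2 f (T p)"
  shows "complex_differentiable2 (\<lambda>q. f (T q)) p"
    "partial_z (\<lambda>q. f (T q)) p =
       partial_z f (T p) * partial_z (fst \<circ> T) p + partial_w f (T p) * partial_z (snd \<circ> T) p"
    "partial_w (\<lambda>q. f (T q)) p =
       partial_z f (T p) * partial_w (fst \<circ> T) p + partial_w f (T p) * partial_w (snd \<circ> T) p"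
proof -
  from has_derivative_compose[OF has_derivative_map2[OF T] has_derivative_partials[OF f]]
  have *: "((\<lambda>q. f (T q)) has_derivative
     (\<lambda>h. (partial_z f (T p) * partial_z (fst \<circ> T) p + partial_w f (T p) * partial_z (snd \<circ> T) p) * fst h
        + (partial_z f (T p) * partial_w (fst \<circ> T) p + partial_w f (T p) * partial_w (snd \<circ> T) p) * snd h)) (at p)"
    by (rule has_derivative_eq_rhs) (simp add: algebra_simps)
  show "complex_differentiable2 (\<lambda>q. f (T q)) p"
    unfolding complex_differentiable2_def using * by blast
  from complex_differentiable2_has_derivative(3,4)[OF *] show
    "partial_z (\<lambda>q. f (T q)) p =
       partial_z f (T p) * partial_z (fst \<circ> T) p + partial_w f (T p) * partial_z (snd \<circ> T) p"
    "partial_w (\<lambda>q. f (T q)) p =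
       partial_z f (T p) * partial_w (fst \<circ> T) p + partial_w f (T p) * partial_w (snd \<circ> T) p"
    by auto
qed

section \<open>The two equations for \<open>\<xi>\<close>\<close>

text \<open>The local data of the problem on one fixed open set: the web of the three foliations cut out by
  \<open>dz\<close>, \<open>dw\<close> and \<open>a dz + b dw\<close>.\<close>

locale web_coefficients =
  fixes N :: "(complex \<times> complex) set" and a b A B \<xi> :: "complex \<times> complex \<Rightarrow> complex"
  assumes open_N: "open N"
    and a_hol: "holomorphic2_on a N" and b_hol: "holomorphic2_on b N"
    and a_nonzero: "\<forall>p\<in>N. a p \<noteq> 0" and b_nonzero: "\<forall>p\<in>N. b p \<noteq> 0"
    and A_eq: "A = partial_z (\<lambda>p. partial_w a p / a p)"
    and B_eq: "B = partial_z (\<lambda>p. partial_w b p / b p)"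
    and AB_nonzero: "\<forall>p\<in>N. A p - B p \<noteq> 0"
    and xi_eq: "\<xi> = (\<lambda>p. 1 / (A p - B p) *
      (a p * partial_z (\<lambda>q. b q / a q * B q) p - b p * partial_w (\<lambda>q. a q / b q * A q) p))"
begin

lemma dlog_a_hol: "holomorphic2_on (\<lambda>p. partial_w a p / a p) N"
  by (intro holomorphic2_intros open_N a_hol a_nonzero)

lemma dlog_b_hol: "holomorphic2_on (\<lambda>p. partial_w b p / b p) N"
  by (intro holomorphic2_intros open_N b_hol b_nonzero)

lemma A_hol: "holomorphic2_on A N" and B_hol: "holomorphic2_on B N"
  unfolding A_eq B_eq by (rule holomorphic2_on_partial_z[OF open_N] dlog_a_hol dlog_b_hol)+

lemma xi_hol: "holomorphic2_on \<xi> N"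
  unfolding xi_eq
  by (intro holomorphic2_intros open_N a_hol b_hol A_hol B_hol a_nonzero b_nonzero AB_nonzero)

text \<open>Put \<open>\<sigma> = s/a\<close> and \<open>L = (log (a/b))\<^sub>w\<close>, so that \<open>L\<^sub>z = A - B\<close>. The equation \<open>(s/b)\<^sub>w = B\<close>
  becomes \<open>L \<sigma> + \<sigma>\<^sub>w = (b/a) B\<close>. Its \<open>z\<close>-derivative, with \<open>\<sigma>\<^sub>z = A\<close> inserted, reads
  \<open>(A - B) \<sigma> + L A + A\<^sub>w = ((b/a) B)\<^sub>z\<close>, where \<open>L A + A\<^sub>w = (b/a) ((a/b) A)\<^sub>w\<close>.\<close>

lemma xi_unique:
  assumes s: "holomorphic2_on s N"
    and sa: "\<And>p. p \<in> N \<Longrightarrow> partial_z (\<lambda>q. s q / a q) p = A p"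
    and sb: "\<And>p. p \<in> N \<Longrightarrow> partial_w (\<lambda>q. s q / b q) p = B p"
    and p: "p \<in> N"
  shows "s p = \<xi> p"
proof -
  define \<sigma> where "\<sigma> = (\<lambda>q. s q / a q)"
  define r where "r = (\<lambda>q. a q / b q)"
  define L where "L = (\<lambda>q. partial_w a q / a q - partial_w b q / b q)"
  have \<sigma>: "holomorphic2_on \<sigma> N" and r: "holomorphic2_on r N" and L: "holomorphic2_on L N"
    unfolding \<sigma>_def r_def L_def
    by (intro holomorphic2_intros open_N s a_hol b_hol a_nonzero b_nonzero)+
  have \<sigma>w: "holomorphic2_on (partial_w \<sigma>) N"
    using holomorphic2_on_partial_w[OF open_N \<sigma>] .
  have cd: "complex_differentiable2 f q" if "holomorphic2_on f N" "q \<in> N" for f q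
    using that by (auto simp: holomorphic2_on_def)
  have rw: "partial_w r q = r q * L q" if "q \<in> N" for q
  proof -
    have nz: "a q \<noteq> 0" "b q \<noteq> 0" using that a_nonzero b_nonzero by auto
    have "partial_w r q = (partial_w a q * b q - a q * partial_w b q) / (b q * b q)"
      unfolding r_def by (rule partial_divide(2)[OF cd[OF a_hol that] cd[OF b_hol that] nz(2)])
    then show ?thesis using nz by (simp add: r_def L_def diff_divide_distrib right_diff_distrib)
  qed
  have B: "b q / a q * B q = L q * \<sigma> q + partial_w \<sigma> q" if q: "q \<in> N" for q
  proof -
    have "B q = partial_w (\<lambda>q. r q * \<sigma> q) q"
      unfolding sb[OF q, symmetric]
      by (rule partial_w_cong[OF open_N q]) (use a_nonzero in \<open>auto simp: r_def \<sigma>_def\<close>)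
    also have "\<dots> = r q * (L q * \<sigma> q + partial_w \<sigma> q)"
      using partial_mult(2)[OF cd[OF r q] cd[OF \<sigma> q]] rw[OF q] by (simp add: algebra_simps)
    finally show ?thesis using q a_nonzero b_nonzero by (simp add: r_def)
  qed
  have Lz: "partial_z L p = A p - B p"
    unfolding L_def A_eq B_eq using partial_diff(1)[OF cd[OF dlog_a_hol p] cd[OF dlog_b_hol p]] .
  have \<sigma>zw: "partial_z (partial_w \<sigma>) p = partial_w A p"
  proof -
    have "partial_z (partial_w \<sigma>) p = partial_w (partial_z \<sigma>) p"
      using mixed_partials[OF open_N \<sigma> p] by simp
    also have "\<dots> = partial_w A p"
      by (rule partial_w_cong[OF open_N p]) (use sa in \<open>simp add: \<sigma>_def\<close>)
    finally show ?thesis .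
  qed
  have "partial_z (\<lambda>q. b q / a q * B q) p = partial_z (\<lambda>q. L q * \<sigma> q + partial_w \<sigma> q) p"
    by (rule partial_z_cong[OF open_N p]) (rule B)
  also have "\<dots> = (A p - B p) * \<sigma> p + L p * A p + partial_w A p"
    using partial_add(1)[OF complex_differentiable2_mult[OF cd[OF L p] cd[OF \<sigma> p]] cd[OF \<sigma>w p]]
      partial_mult(1)[OF cd[OF L p] cd[OF \<sigma> p]] sa[OF p] Lz \<sigma>zw by (simp add: \<sigma>_def)
  finally have 1: "partial_z (\<lambda>q. b q / a q * B q) p = (A p - B p) * \<sigma> p + L p * A p + partial_w A p" .
  have "partial_w (\<lambda>q. r q * A q) p = r p * (L p * A p + partial_w A p)"
    using partial_mult(2)[OF cd[OF r p] cd[OF A_hol p]] rw[OF p] by (simp add: algebra_simps)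
  then have 2: "b p * partial_w (\<lambda>q. a q / b q * A q) p = a p * (L p * A p + partial_w A p)"
    using p b_nonzero by (simp add: r_def)
  have "\<xi> p = 1 / (A p - B p) * (a p * ((A p - B p) * \<sigma> p))"
    unfolding xi_eq 1 2 by (simp add: algebra_simps)
  also have "\<dots> = s p"
    using AB_nonzero a_nonzero p by (simp add: \<sigma>_def)
  finally show ?thesis ..
qed

text \<open>With \<open>h = 1/(P Q)\<close> the common value of \<open>(h a)\<^sub>w/h\<close> and \<open>(h b)\<^sub>z/h\<close> is \<open>s = P Q F\<^sub>w\<close>. It satisfies
  \<open>s/a = a\<^sub>w/a - Q\<^sub>w/Q\<close> and \<open>s/b = b\<^sub>z/b - P\<^sub>z/P\<close>, and the terms in \<open>Q\<close> and \<open>P\<close> do not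
  contribute to the mixed derivatives. By uniqueness \<open>s = \<xi>\<close>.\<close>

lemma xi_equations_of_closed_factors:
  assumes P: "holomorphic2_on P N" "\<And>p. p \<in> N \<Longrightarrow> partial_w P p = 0"
    and Q: "holomorphic2_on Q N" "\<And>p. p \<in> N \<Longrightarrow> partial_z Q p = 0"
    and F: "holomorphic2_on F N" "\<And>p. p \<in> N \<Longrightarrow> P p * Q p * F p = a p"
    and G: "holomorphic2_on G N" "\<And>p. p \<in> N \<Longrightarrow> P p * Q p * G p = b p"
    and closed: "\<And>p. p \<in> N \<Longrightarrow> partial_z G p = partial_w F p"
    and p: "p \<in> N"
  shows "partial_z (\<lambda>q. \<xi> q / a q) p = A p" "partial_w (\<lambda>q. \<xi> q / b q) p = B p"
proof -
  have cd: "complex_differentiable2 f q" if "holomorphic2_on f N" "q \<in> N" for f q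
    using that by (auto simp: holomorphic2_on_def)
  have nz: "P q \<noteq> 0" "Q q \<noteq> 0" "F q \<noteq> 0" "G q \<noteq> 0" if "q \<in> N" for q
    using F(2)[OF that] G(2)[OF that] a_nonzero b_nonzero that by auto
  define s where "s = (\<lambda>q. P q * Q q * partial_w F q)"
  have s: "holomorphic2_on s N"
    unfolding s_def by (intro holomorphic2_on_mult P Q holomorphic2_on_partial_w F open_N)
  have PQ: "holomorphic2_on (\<lambda>q. P q * Q q) N"
    by (intro holomorphic2_intros P Q)
  have sa: "s q / a q = partial_w a q / a q - partial_w Q q / Q q" if q: "q \<in> N" for q
  proof -
    have "partial_w a q = partial_w (\<lambda>q. P q * Q q * F q) q"
      by (rule partial_w_cong[OF open_N q]) (simp add: F)
    also have "\<dots> = P q * partial_w Q q * F q + P q * Q q * partial_w F q"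
      using partial_mult(2)[OF cd[OF PQ q] cd[OF F(1) q]] partial_mult(2)[OF cd[OF P(1) q] cd[OF Q(1) q]] P(2)[OF q]
      by simp
    finally show ?thesis
      unfolding F(2)[OF q, symmetric] s_def using nz[OF q] by (simp add: add_divide_distrib)
  qed
  have sb: "s q / b q = partial_z b q / b q - partial_z P q / P q" if q: "q \<in> N" for q
  proof -
    have "partial_z b q = partial_z (\<lambda>q. P q * Q q * G q) q"
      by (rule partial_z_cong[OF open_N q]) (simp add: G)
    also have "\<dots> = partial_z P q * Q q * G q + P q * Q q * partial_w F q"
      using partial_mult(1)[OF cd[OF PQ q] cd[OF G(1) q]] partial_mult(1)[OF cd[OF P(1) q] cd[OF Q(1) q]] Q(2)[OF q] closed[OF q]
      by simp
    finally show ?thesis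
      unfolding G(2)[OF q, symmetric] s_def closed[OF q, symmetric] using nz[OF q] by (simp add: add_divide_distrib)
  qed
  have Qw: "holomorphic2_on (partial_w Q) N" and Pz: "holomorphic2_on (partial_z P) N"
    by (intro holomorphic2_intros open_N P Q)+
  have sA: "partial_z (\<lambda>q. s q / a q) q = A q" if q: "q \<in> N" for q
  proof -
    have "partial_z (\<lambda>q. s q / a q) q = partial_z (\<lambda>q. partial_w a q / a q - partial_w Q q / Q q) q"
      by (rule partial_z_cong[OF open_N q]) (rule sa)
    also have "\<dots> = A q - partial_z (\<lambda>q. partial_w Q q / Q q) q"
      unfolding A_eq using nz[OF q]
      by (intro partial_diff(1) complex_differentiable2_divide cd[OF dlog_a_hol q] cd[OF Qw q] cd[OF Q(1) q])
    also have "partial_z (\<lambda>q. partial_w Q q / Q q) q = partial_w (\<lambda>q. partial_z Q q / Q q) q"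
      using mixed_partials_log[OF open_N Q(1) _ q] nz by simp
    also have "\<dots> = partial_w (\<lambda>_. 0) q"
      by (rule partial_w_cong[OF open_N q]) (simp add: Q)
    finally show ?thesis by simp
  qed
  have sB: "partial_w (\<lambda>q. s q / b q) q = B q" if q: "q \<in> N" for q
  proof -
    have bz: "complex_differentiable2 (\<lambda>q. partial_z b q / b q) q"
      using q b_nonzero by (intro complex_differentiable2_divide cd[OF b_hol] cd[OF holomorphic2_on_partial_z[OF open_N b_hol]]) auto
    have "partial_w (\<lambda>q. s q / b q) q = partial_w (\<lambda>q. partial_z b q / b q - partial_z P q / P q) q"
      by (rule partial_w_cong[OF open_N q]) (rule sb)
    also have "\<dots> = partial_w (\<lambda>q. partial_z b q / b q) q - partial_w (\<lambda>q. partial_z P q / P q) q"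
      using nz[OF q]
      by (intro partial_diff(2) complex_differentiable2_divide bz cd[OF Pz q] cd[OF P(1) q])
    also have "partial_w (\<lambda>q. partial_z b q / b q) q = B q"
      unfolding B_eq by (rule mixed_partials_log[OF open_N b_hol b_nonzero q])
    also have "partial_w (\<lambda>q. partial_z P q / P q) q = partial_z (\<lambda>q. partial_w P q / P q) q"
      using mixed_partials_log[OF open_N P(1) _ q] nz by simp
    also have "\<dots> = partial_z (\<lambda>_. 0) q"
      by (rule partial_z_cong[OF open_N q]) (simp add: P)
    finally show ?thesis by simp
  qed
  have eq: "\<xi> q = s q" if "q \<in> N" for q
    using xi_unique[OF s sA sB that] by simp
  show "partial_z (\<lambda>q. \<xi> q / a q) p = A p"
    unfolding sA[OF p, symmetric] by (rule partial_z_cong[OF open_N p]) (simp add: eq)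
  show "partial_w (\<lambda>q. \<xi> q / b q) p = B p"
    unfolding sB[OF p, symmetric] by (rule partial_w_cong[OF open_N p]) (simp add: eq)
qed

end

text \<open>A product of discs has connected slices, so a vanishing partial derivative really means
  independence of that variable.\<close>

lemma partial_z_zero_imp_const:
  assumes "\<And>p. p \<in> ball z0 r \<times> ball w0 r \<Longrightarrow> complex_differentiable2 f p"
    "\<And>p. p \<in> ball z0 r \<times> ball w0 r \<Longrightarrow> partial_z f p = 0" "z \<in> ball z0 r" "w \<in> ball w0 r"
  shows "f (z, w) = f (z0, w)"
proof -
  have r: "r > 0" using assms(3) by (auto intro: le_less_trans[OF zero_le_dist])
  have "((\<lambda>t. f (t, w)) has_field_derivative 0) (at t within ball z0 r)" if "t \<in> ball z0 r" for t
    using partial_z_DERIV[OF assms(1), of "(t, w)"] assms(2)[of "(t, w)"] assms(4) that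
    by (auto intro: has_field_derivative_at_within)
  then obtain c where "\<And>t. t \<in> ball z0 r \<Longrightarrow> f (t, w) = c"
    using has_field_derivative_zero_constant[OF convex_ball] by blast
  then show ?thesis using assms(3) r by simp
qed

lemma partial_w_zero_imp_const:
  assumes "\<And>p. p \<in> ball z0 r \<times> ball w0 r \<Longrightarrow> complex_differentiable2 f p"
    "\<And>p. p \<in> ball z0 r \<times> ball w0 r \<Longrightarrow> partial_w f p = 0" "z \<in> ball z0 r" "w \<in> ball w0 r"
  shows "f (z, w) = f (z, w0)"
proof -
  have r: "r > 0" using assms(3) by (auto intro: le_less_trans[OF zero_le_dist])
  have "((\<lambda>t. f (z, t)) has_field_derivative 0) (at t within ball w0 r)" if "t \<in> ball w0 r" for t
    using partial_w_DERIV[OF assms(1), of "(z, t)"] assms(2)[of "(z, t)"] assms(3) that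
    by (auto intro: has_field_derivative_at_within)
  then obtain c where "\<And>t. t \<in> ball w0 r \<Longrightarrow> f (z, t) = c"
    using has_field_derivative_zero_constant[OF convex_ball] by blast
  then show ?thesis using assms(4) r by simp
qed

lemma exp_primitive_compose:
  assumes "(u has_field_derivative D) (at (fst p))" "(v has_field_derivative E) (at (snd p))"
  shows "complex_differentiable2 (\<lambda>q. exp (u (fst q) + v (snd q))) p"
    "partial_z (\<lambda>q. exp (u (fst q) + v (snd q))) p = exp (u (fst p) + v (snd p)) * D"
    "partial_w (\<lambda>q. exp (u (fst q) + v (snd q))) p = exp (u (fst p) + v (snd p)) * E"
proof -
  have "complex_differentiable2 (\<lambda>q. u (fst q) + v (snd q)) p"
    by (intro complex_differentiable2_add complex_differentiable2_compose_field[OF complex_differentiable2_fst assms(1)]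
        complex_differentiable2_compose_field[OF complex_differentiable2_snd assms(2)])
  then show "complex_differentiable2 (\<lambda>q. exp (u (fst q) + v (snd q))) p"
    by (rule complex_differentiable2_compose_field) (rule DERIV_exp)
  show "partial_z (\<lambda>q. exp (u (fst q) + v (snd q))) p = exp (u (fst p) + v (snd p)) * D"
    unfolding partial_z_def
    by (rule DERIV_imp_deriv) (auto intro!: derivative_eq_intros assms)
  show "partial_w (\<lambda>q. exp (u (fst q) + v (snd q))) p = exp (u (fst p) + v (snd p)) * E"
    unfolding partial_w_def
    by (rule DERIV_imp_deriv) (auto intro!: derivative_eq_intros assms)
qed

context web_coefficients
begin

text \<open>The functions \<open>\<alpha> = \<xi>/b - b\<^sub>z/b\<close> of \<open>z\<close> and \<open>\<beta> = \<xi>/a - a\<^sub>w/a\<close> of \<open>w\<close> have primitives \<open>u\<close> and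
  \<open>v\<close> on the two discs; take \<open>P = exp (-u)\<close>, \<open>Q = exp (-v)\<close> and \<open>h = exp (u + v)\<close>. Then both
  sides of the last equation are \<open>h \<xi>\<close>.\<close>

lemma closed_factors_of_xi_equations:
  assumes sub: "ball z0 r \<times> ball w0 r \<subseteq> N"
    and xa: "\<And>p. p \<in> N \<Longrightarrow> partial_z (\<lambda>q. \<xi> q / a q) p = A p"
    and xb: "\<And>p. p \<in> N \<Longrightarrow> partial_w (\<lambda>q. \<xi> q / b q) p = B p"
  obtains P Q h where
    "holomorphic2_on P (ball z0 r \<times> ball w0 r)" "\<And>p. p \<in> ball z0 r \<times> ball w0 r \<Longrightarrow> partial_w P p = 0"
    "holomorphic2_on Q (ball z0 r \<times> ball w0 r)" "\<And>p. p \<in> ball z0 r \<times> ball w0 r \<Longrightarrow> partial_z Q p = 0"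
    "holomorphic2_on h (ball z0 r \<times> ball w0 r)" "\<And>p. P p * Q p * h p = 1"
    "\<And>p. p \<in> ball z0 r \<times> ball w0 r \<Longrightarrow> partial_z (\<lambda>q. h q * b q) p = partial_w (\<lambda>q. h q * a q) p"
proof -
  let ?D = "ball z0 r \<times> ball w0 r"
  have cd: "complex_differentiable2 f q" if "holomorphic2_on f N" "q \<in> N" for f q
    using that by (auto simp: holomorphic2_on_def)
  have bz_hol: "holomorphic2_on (\<lambda>q. partial_z b q / b q) N"
    by (intro holomorphic2_intros open_N b_hol b_nonzero)
  have xa_hol: "holomorphic2_on (\<lambda>q. \<xi> q / a q) N" and xb_hol: "holomorphic2_on (\<lambda>q. \<xi> q / b q) N"
    by (intro holomorphic2_intros xi_hol a_hol b_hol a_nonzero b_nonzero)+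
  define \<alpha> where "\<alpha> = (\<lambda>q. \<xi> q / b q - partial_z b q / b q)"
  define \<beta> where "\<beta> = (\<lambda>q. \<xi> q / a q - partial_w a q / a q)"
  have \<alpha>: "holomorphic2_on \<alpha> N" and \<beta>: "holomorphic2_on \<beta> N"
    unfolding \<alpha>_def \<beta>_def by (intro holomorphic2_on_diff xa_hol xb_hol bz_hol dlog_a_hol)+
  have \<alpha>w: "partial_w \<alpha> q = 0" if "q \<in> N" for q
    unfolding \<alpha>_def using partial_diff(2)[OF cd[OF xb_hol that] cd[OF bz_hol that]] xb[OF that]
      mixed_partials_log[OF open_N b_hol b_nonzero that] by (simp add: B_eq)
  have \<beta>z: "partial_z \<beta> q = 0" if "q \<in> N" for q
    unfolding \<beta>_def using partial_diff(1)[OF cd[OF xa_hol that] cd[OF dlog_a_hol that]] xa[OF that]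
    by (simp add: A_eq)
  have \<alpha>c: "\<alpha> (z, w) = \<alpha> (z, w0)" if "z \<in> ball z0 r" "w \<in> ball w0 r" for z w
    by (rule partial_w_zero_imp_const[OF _ _ that]) (use cd[OF \<alpha>] \<alpha>w sub in auto)
  have \<beta>c: "\<beta> (z, w) = \<beta> (z0, w)" if "z \<in> ball z0 r" "w \<in> ball w0 r" for z w
    by (rule partial_z_zero_imp_const[OF _ _ that]) (use cd[OF \<beta>] \<beta>z sub in auto)
  have ne: "w0 \<in> ball w0 r" "z0 \<in> ball z0 r" if "t \<in> ball z0 r \<or> t \<in> ball w0 r" for t
    using that by (auto intro: le_less_trans[OF zero_le_dist])
  have "(\<lambda>t. \<alpha> (t, w0)) holomorphic_on ball z0 r"
    unfolding holomorphic_on_def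
  proof
    fix t assume t: "t \<in> ball z0 r"
    then have "(t, w0) \<in> N" using subsetD[OF sub, of "(t, w0)"] ne[of t] by simp
    from partial_z_DERIV[OF cd[OF \<alpha> this]] show "(\<lambda>t. \<alpha> (t, w0)) field_differentiable at t within ball z0 r"
      by - (rule field_differentiable_at_within, auto simp: field_differentiable_def)
  qed
  then obtain u where "\<And>t. t \<in> ball z0 r \<Longrightarrow> (u has_field_derivative \<alpha> (t, w0)) (at t within ball z0 r)"
    using holomorphic_convex_primitive'[OF convex_ball open_ball] by blast
  then have u: "(u has_field_derivative \<alpha> (t, w0)) (at t)" if "t \<in> ball z0 r" for t
    using that at_within_open[OF that open_ball] by metis
  have "(\<lambda>t. \<beta> (z0, t)) holomorphic_on ball w0 r"
    unfolding holomorphic_on_def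
  proof
    fix t assume t: "t \<in> ball w0 r"
    then have "(z0, t) \<in> N" using subsetD[OF sub, of "(z0, t)"] ne[of t] by simp
    from partial_w_DERIV[OF cd[OF \<beta> this]] show "(\<lambda>t. \<beta> (z0, t)) field_differentiable at t within ball w0 r"
      by - (rule field_differentiable_at_within, auto simp: field_differentiable_def)
  qed
  then obtain v where "\<And>t. t \<in> ball w0 r \<Longrightarrow> (v has_field_derivative \<beta> (z0, t)) (at t within ball w0 r)"
    using holomorphic_convex_primitive'[OF convex_ball open_ball] by blast
  then have v: "(v has_field_derivative \<beta> (z0, t)) (at t)" if "t \<in> ball w0 r" for t
    using that at_within_open[OF that open_ball] by metis
  have u': "((\<lambda>t. - u t) has_field_derivative - \<alpha> (t, w0)) (at t)" if "t \<in> ball z0 r" for t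
    using DERIV_minus[OF u[OF that]] .
  have v': "((\<lambda>t. - v t) has_field_derivative - \<beta> (z0, t)) (at t)" if "t \<in> ball w0 r" for t
    using DERIV_minus[OF v[OF that]] .
  let ?h = "\<lambda>q. exp (u (fst q) + v (snd q))"
  have h: "complex_differentiable2 ?h q" "partial_z ?h q = ?h q * \<alpha> q" "partial_w ?h q = ?h q * \<beta> q"
    if "q \<in> ?D" for q
    using exp_primitive_compose[OF u v, of q] that \<alpha>c[of "fst q" "snd q"] \<beta>c[of "fst q" "snd q"]
    by (auto simp: mem_Times_iff)
  show thesis
  \<comment> \<open>The summands \<open>0\<close> give \<open>P\<close> and \<open>Q\<close> the form of \<open>exp_primitive_compose\<close>, with a constant as the other primitive.\<close>
  proof (rule that[of "\<lambda>q. exp (- u (fst q) + 0)" "\<lambda>q. exp (0 + - v (snd q))" ?h])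
    show "holomorphic2_on (\<lambda>q. exp (- u (fst q) + 0)) ?D"
      unfolding holomorphic2_on_def
      using exp_primitive_compose(1)[OF u' DERIV_const[of 0]] by auto
    show "holomorphic2_on (\<lambda>q. exp (0 + - v (snd q))) ?D"
      unfolding holomorphic2_on_def
      using exp_primitive_compose(1)[OF DERIV_const[of 0] v'] by auto
    show "holomorphic2_on ?h ?D" using h(1) by (simp add: holomorphic2_on_def)
    show "exp (- u (fst p) + 0) * exp (0 + - v (snd p)) * ?h p = 1" for p
      by (simp flip: exp_add)
    show "partial_w (\<lambda>q. exp (- u (fst q) + 0)) p = 0" for p by (simp add: partial_w_def)
    show "partial_z (\<lambda>q. exp (0 + - v (snd q))) p = 0" for p by (simp add: partial_z_def)
    fix p assume p: "p \<in> ?D"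
    then have pN: "p \<in> N" using sub by auto
    have "partial_z (\<lambda>q. ?h q * b q) p = ?h p * (\<alpha> p * b p + partial_z b p)"
      using partial_mult(1)[OF h(1)[OF p] cd[OF b_hol pN]] h(2)[OF p] by (simp add: algebra_simps)
    also have "\<alpha> p * b p + partial_z b p = \<beta> p * a p + partial_w a p"
      using pN a_nonzero b_nonzero by (simp add: \<alpha>_def \<beta>_def field_simps)
    also have "?h p * (\<beta> p * a p + partial_w a p) = partial_w (\<lambda>q. ?h q * a q) p"
      using partial_mult(2)[OF h(1)[OF p] cd[OF a_hol pN]] h(3)[OF p] by (simp add: algebra_simps)
    finally show "partial_z (\<lambda>q. ?h q * b q) p = partial_w (\<lambda>q. ?h q * a q) p" .
  qed
qed

end

section \<open>Charts, tangent vectors and closed 1-forms\<close>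

lemma chart_inj: "is_chart X c \<Longrightarrow> inj_on (snd c) (fst c)"
  using openin_subset[of X "fst c"]
  by (auto simp: is_chart_def case_prod_unfold homeomorphic_eq_everything_map Int_absorb1)

lemma chart_openin: "is_chart X c \<Longrightarrow> openin X (fst c)"
  by (simp add: is_chart_def case_prod_unfold)

lemma chart_open_image:
  assumes "is_chart X c" "openin X W"
  shows "open (snd c ` (fst c \<inter> W))"
proof -
  have "open_map (subtopology X (fst c)) (top_of_set (snd c ` fst c)) (snd c)"
    using assms(1) by (auto simp: is_chart_def case_prod_unfold homeomorphic_eq_everything_map)
  moreover have "openin (subtopology X (fst c)) (fst c \<inter> W)"
    using assms(2) by (rule openin_subtopology_Int2)
  ultimately have "openin (top_of_set (snd c ` fst c)) (snd c ` (fst c \<inter> W))"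
    by (auto simp: open_map_def)
  moreover have "open (snd c ` fst c)"
    using assms(1) by (simp add: is_chart_def case_prod_unfold)
  ultimately show ?thesis by (metis openin_open_eq)
qed

lemma chart_openin_preimage:
  assumes "is_chart X c" "open S"
  shows "openin X {y \<in> fst c. snd c y \<in> S}"
proof -
  have c: "continuous_map (subtopology X (fst c)) (top_of_set (snd c ` fst c)) (snd c)"
    using assms(1) by (auto simp: is_chart_def case_prod_unfold homeomorphic_eq_everything_map)
  have "openin (top_of_set (snd c ` fst c)) (snd c ` fst c \<inter> S)"
    using assms(2) by (rule openin_open_Int)
  from openin_continuous_map_preimage[OF c this]
  have "openin (subtopology X (fst c)) {y \<in> topspace (subtopology X (fst c)). snd c y \<in> snd c ` fst c \<inter> S}" .
  moreover have "{y \<in> topspace (subtopology X (fst c)). snd c y \<in> snd c ` fst c \<inter> S} = {y \<in> fst c. snd c y \<in> S}"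
    using openin_subset[OF chart_openin[OF assms(1)]] by auto
  ultimately show ?thesis
    using openin_open_subtopology[OF chart_openin[OF assms(1)]] by auto
qed

lemma transition_apply: "is_chart X c \<Longrightarrow> y \<in> fst c \<Longrightarrow> transition c c' (snd c y) = snd c' y"
  by (simp add: transition_def chart_inj)

lemma transition_self_derivative:
  assumes "is_chart X c" "y \<in> fst c"
  shows "(transition c c has_derivative (\<lambda>h. h)) (at (snd c y))"
proof (rule has_derivative_transform_within_open[OF has_derivative_ident])
  show "open (snd c ` fst c)"
    using assms(1) by (simp add: is_chart_def case_prod_unfold)
qed (use assms in \<open>auto simp: transition_apply\<close>)

lemma holomorphic_chartsD:
  assumes "c \<in> holomorphic_charts X \<A>"
  shows "is_chart X c" "e \<in> \<A> \<Longrightarrow> holomorphic_transition c e" "e \<in> \<A> \<Longrightarrow> holomorphic_transition e c"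
  using assms by (auto simp: holomorphic_charts_def compatible_charts_def)

text \<open>Compatibility is only postulated with the charts of \<open>\<A>\<close>. Near a given point the transition between
  two charts of the maximal atlas factors through a chart of \<open>\<A>\<close>.\<close>

lemma holomorphic_transition_charts:
  assumes "complex_surface X \<A>" and c: "c \<in> holomorphic_charts X \<A>" and c': "c' \<in> holomorphic_charts X \<A>"
  shows "holomorphic_transition c c'"
proof -
  have main: "complex_differentiable2 (fst \<circ> transition c c') (snd c y) \<and>
    complex_differentiable2 (snd \<circ> transition c c') (snd c y)" if y: "y \<in> fst c" "y \<in> fst c'" for y
  proof -
    have "y \<in> topspace X" using y(1) openin_subset[OF chart_openin[OF holomorphic_chartsD(1)[OF c]]] by auto
    then obtain e where e: "e \<in> \<A>" "y \<in> fst e"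
      using assms(1) unfolding complex_surface_def by blast
    have ch: "is_chart X c" "is_chart X c'" "is_chart X e"
      using holomorphic_chartsD(1)[OF c] holomorphic_chartsD(1)[OF c'] e(1) assms(1)
      by (auto simp: complex_surface_def)
    let ?S = "snd c ` (fst c \<inter> (fst c' \<inter> fst e))"
    have S: "open ?S" by (intro chart_open_image[OF ch(1)] openin_Int chart_openin[OF ch(2)] chart_openin[OF ch(3)])
    have yS: "snd c y \<in> ?S" using y e by auto
    have eq: "transition e c' (transition c e q) = transition c c' q" if "q \<in> ?S" for q
      using that ch by (auto simp: transition_apply)
    have T: "complex_differentiable2 (fst \<circ> transition c e) (snd c y)"
        "complex_differentiable2 (snd \<circ> transition c e) (snd c y)"
      using holomorphic_chartsD(2)[OF c e(1)] y(1) e(2)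
      by (auto simp: holomorphic_transition_def holomorphic2_on_def)
    have T': "complex_differentiable2 (fst \<circ> transition e c') (transition c e (snd c y))"
        "complex_differentiable2 (snd \<circ> transition e c') (transition c e (snd c y))"
      using holomorphic_chartsD(3)[OF c' e(1)] y e(2) transition_apply[OF ch(1) y(1)]
      by (auto simp: holomorphic_transition_def holomorphic2_on_def)
    show ?thesis
      using complex_differentiable2_compose(1)[OF T T'(1)] complex_differentiable2_compose(1)[OF T T'(2)]
        complex_differentiable2_cong[OF S yS, of "\<lambda>q. (fst \<circ> transition e c') (transition c e q)" "fst \<circ> transition c c'"]
        complex_differentiable2_cong[OF S yS, of "\<lambda>q. (snd \<circ> transition e c') (transition c e q)" "snd \<circ> transition c c'"]
        eq by simp
  qed
  then show ?thesis
    by (auto simp: holomorphic_transition_def holomorphic2_on_def)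
qed

lemma transition_has_derivative:
  assumes "complex_surface X \<A>" and "c \<in> charts_at X \<A> y" and "c' \<in> charts_at X \<A> y"
  shows "(transition c c' has_derivative
    (\<lambda>h. (partial_z (fst \<circ> transition c c') (snd c y) * fst h + partial_w (fst \<circ> transition c c') (snd c y) * snd h,
          partial_z (snd \<circ> transition c c') (snd c y) * fst h + partial_w (snd \<circ> transition c c') (snd c y) * snd h)))
    (at (snd c y))"
  using holomorphic_transition_charts[OF assms(1), of c c'] assms(2,3)
  by (intro has_derivative_map2) (auto simp: holomorphic_transition_def holomorphic2_on_def charts_at_def)

lemma frechet_derivative_transition_chain:
  assumes X: "complex_surface X \<A>" and c: "c \<in> charts_at X \<A> y" "c' \<in> charts_at X \<A> y" "c'' \<in> charts_at X \<A> y"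
  shows "frechet_derivative (transition c c'') (at (snd c y)) h =
    frechet_derivative (transition c' c'') (at (snd c' y)) (frechet_derivative (transition c c') (at (snd c y)) h)"
proof -
  have ch: "is_chart X c" "is_chart X c'" "is_chart X c''" "y \<in> fst c" "y \<in> fst c'" "y \<in> fst c''"
    using c by (auto simp: charts_at_def dest: holomorphic_chartsD(1))
  let ?S = "snd c ` (fst c \<inter> (fst c' \<inter> fst c''))"
  have S: "open ?S" by (intro chart_open_image[OF ch(1)] openin_Int chart_openin[OF ch(2)] chart_openin[OF ch(3)])
  have d1: "(transition c c' has_derivative frechet_derivative (transition c c') (at (snd c y))) (at (snd c y))"
    unfolding frechet_derivative_works[symmetric]
    by (rule differentiableI[OF transition_has_derivative[OF X c(1,2)]])
  have "(transition c' c'' has_derivative frechet_derivative (transition c' c'') (at (snd c' y))) (at (snd c' y))"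
    unfolding frechet_derivative_works[symmetric]
    by (rule differentiableI[OF transition_has_derivative[OF X c(2,3)]])
  then have d2: "(transition c' c'' has_derivative frechet_derivative (transition c' c'') (at (snd c' y))) (at (transition c c' (snd c y)))"
    by (simp add: transition_apply[OF ch(1,4)])
  have "(transition c c'' has_derivative
     (\<lambda>h. frechet_derivative (transition c' c'') (at (snd c' y)) (frechet_derivative (transition c c') (at (snd c y)) h))) (at (snd c y))"
    by (rule has_derivative_transform_within_open[OF has_derivative_compose[OF d1 d2] S])
      (use ch in \<open>auto simp: transition_apply\<close>)
  from fun_cong[OF frechet_derivative_at[OF this]] show ?thesis by simp
qed

text \<open>The components in the other charts are forced by the Jacobians; the chain rule makes them
  consistent.\<close>

lemma tangent_vector_exists:
  assumes X: "complex_surface X \<A>" and c: "c \<in> charts_at X \<A> y"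
  obtains v where "v \<in> tangent_space X \<A> y" "v c = h"
proof
  define v where "v = (\<lambda>c'. if c' \<in> charts_at X \<A> y then frechet_derivative (transition c c') (at (snd c y)) h else 0)"
  show "v \<in> tangent_space X \<A> y"
    unfolding tangent_space_def v_def
    by (simp, intro ballI) (rule frechet_derivative_transition_chain[OF X c])
  have "is_chart X c" "y \<in> fst c"
    using c by (auto simp: charts_at_def dest: holomorphic_chartsD(1))
  from fun_cong[OF frechet_derivative_at[OF transition_self_derivative[OF this]], of h] show "v c = h"
    using c by (simp add: v_def)
qed

lemma tangent_transform:
  assumes X: "complex_surface X \<A>" and c: "c \<in> charts_at X \<A> y" "c' \<in> charts_at X \<A> y"
    and v: "v \<in> tangent_space X \<A> y"
  defines "T \<equiv> transition c c'"
  shows "coord_dz c' v = partial_z (fst \<circ> T) (snd c y) * coord_dz c v + partial_w (fst \<circ> T) (snd c y) * coord_dw c v"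
    "coord_dw c' v = partial_z (snd \<circ> T) (snd c y) * coord_dz c v + partial_w (snd \<circ> T) (snd c y) * coord_dw c v"
proof -
  have "v c' = frechet_derivative T (at (snd c y)) (v c)"
    using v c unfolding T_def tangent_space_def by blast
  also have "\<dots> = (partial_z (fst \<circ> T) (snd c y) * fst (v c) + partial_w (fst \<circ> T) (snd c y) * snd (v c),
          partial_z (snd \<circ> T) (snd c y) * fst (v c) + partial_w (snd \<circ> T) (snd c y) * snd (v c))"
    using fun_cong[OF frechet_derivative_at[OF transition_has_derivative[OF X c]], of "v c"]
    unfolding T_def by simp
  finally show "coord_dz c' v = partial_z (fst \<circ> T) (snd c y) * coord_dz c v + partial_w (fst \<circ> T) (snd c y) * coord_dw c v"
    "coord_dw c' v = partial_z (snd \<circ> T) (snd c y) * coord_dz c v + partial_w (snd \<circ> T) (snd c y) * coord_dw c v"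
    by (simp_all add: coord_dz_def coord_dw_def)
qed

text \<open>Closedness has to be known in every chart, but it suffices to check it in one. By the chain rule and
  the symmetry of second derivatives, pulling back along a transition map multiplies \<open>g\<^sub>z - f\<^sub>w\<close> by
  the Jacobian determinant.\<close>

lemma closed_1form_onI:
  assumes X: "complex_surface X \<A>" and c0: "c0 \<in> holomorphic_charts X \<A>"
    and V: "openin X V" "V \<subseteq> fst c0"
    and f: "holomorphic2_on f (snd c0 ` V)" and g: "holomorphic2_on g (snd c0 ` V)"
    and closed: "\<And>p. p \<in> snd c0 ` V \<Longrightarrow> partial_z g p = partial_w f p"
  shows "closed_1form_on X \<A> V (\<lambda>y v. f (snd c0 y) * coord_dz c0 v + g (snd c0 y) * coord_dw c0 v)"
  unfolding closed_1form_on_def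
proof
  fix c assume c: "c \<in> holomorphic_charts X \<A>"
  define S where "S = snd c ` (fst c \<inter> V)"
  define T where "T = transition c c0"
  define T1 where "T1 = fst \<circ> T"
  define T2 where "T2 = snd \<circ> T"
  have chart: "is_chart X c" using holomorphic_chartsD(1)[OF c] .
  have S: "open S" unfolding S_def by (rule chart_open_image[OF chart V(1)])
  have T_apply: "T (snd c y) = snd c0 y" if "y \<in> fst c" for y
    unfolding T_def by (rule transition_apply[OF chart that])
  have TS: "T p \<in> snd c0 ` V" if "p \<in> S" for p
    using that T_apply by (auto simp: S_def)
  have "holomorphic_transition c c0" by (rule holomorphic_transition_charts[OF X c c0])
  then have T12: "holomorphic2_on T1 S" "holomorphic2_on T2 S"
    using V(2) by (auto simp: T1_def T2_def T_def holomorphic_transition_def holomorphic2_on_def S_def)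
  have comp: "complex_differentiable2 (\<lambda>q. k (T q)) p"
    "partial_z (\<lambda>q. k (T q)) p = partial_z k (T p) * partial_z T1 p + partial_w k (T p) * partial_z T2 p"
    "partial_w (\<lambda>q. k (T q)) p = partial_z k (T p) * partial_w T1 p + partial_w k (T p) * partial_w T2 p"
    if "holomorphic2_on k (snd c0 ` V)" "p \<in> S" for k p
  proof -
    have "complex_differentiable2 (fst \<circ> T) p" "complex_differentiable2 (snd \<circ> T) p"
      "complex_differentiable2 k (T p)"
      using T12 that TS[OF that(2)] unfolding T1_def T2_def holomorphic2_on_def by blast+
    from complex_differentiable2_compose[OF this] show "complex_differentiable2 (\<lambda>q. k (T q)) p"
      "partial_z (\<lambda>q. k (T q)) p = partial_z k (T p) * partial_z T1 p + partial_w k (T p) * partial_z T2 p"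
      "partial_w (\<lambda>q. k (T q)) p = partial_z k (T p) * partial_w T1 p + partial_w k (T p) * partial_w T2 p"
      by (simp_all add: T1_def T2_def)
  qed
  have fT: "holomorphic2_on (\<lambda>q. f (T q)) S" and gT: "holomorphic2_on (\<lambda>q. g (T q)) S"
    using comp(1)[OF f] comp(1)[OF g] by (auto simp: holomorphic2_on_def)
  have cd: "complex_differentiable2 k q" if "holomorphic2_on k S" "q \<in> S" for k q
    using that by (auto simp: holomorphic2_on_def)
  let ?f = "\<lambda>p. f (T p) * partial_z T1 p + g (T p) * partial_z T2 p"
  let ?g = "\<lambda>p. f (T p) * partial_w T1 p + g (T p) * partial_w T2 p"
  have "holomorphic2_on ?f S" "holomorphic2_on ?g S"
    by (intro holomorphic2_intros S T12 fT gT)+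
  moreover have "f (snd c0 y) * coord_dz c0 v + g (snd c0 y) * coord_dw c0 v =
      ?f (snd c y) * coord_dz c v + ?g (snd c y) * coord_dw c v"
    if "y \<in> fst c \<inter> V" "v \<in> tangent_space X \<A> y" for y v
  proof -
    have "c \<in> charts_at X \<A> y" "c0 \<in> charts_at X \<A> y"
      using that c c0 V(2) by (auto simp: charts_at_def)
    from tangent_transform[OF X this that(2)] T_apply that(1) show ?thesis
      by (simp add: T1_def T2_def T_def algebra_simps)
  qed
  moreover have "partial_z ?g p - partial_w ?f p = 0" if p: "p \<in> S" for p
  proof -
    have cds: "complex_differentiable2 (\<lambda>q. f (T q)) p" "complex_differentiable2 (\<lambda>q. g (T q)) p"
      "complex_differentiable2 (partial_z T1) p" "complex_differentiable2 (partial_w T1) p"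
      "complex_differentiable2 (partial_z T2) p" "complex_differentiable2 (partial_w T2) p"
      by (intro cd p fT gT holomorphic2_intros S T12)+
    have "partial_z ?g p = partial_z (\<lambda>q. f (T q)) p * partial_w T1 p + f (T p) * partial_z (partial_w T1) p
      + (partial_z (\<lambda>q. g (T q)) p * partial_w T2 p + g (T p) * partial_z (partial_w T2) p)"
      by (simp add: partial_add partial_mult complex_differentiable2_mult cds)
    moreover have "partial_w ?f p = partial_w (\<lambda>q. f (T q)) p * partial_z T1 p + f (T p) * partial_z (partial_w T1) p
      + (partial_w (\<lambda>q. g (T q)) p * partial_z T2 p + g (T p) * partial_z (partial_w T2) p)"
      by (simp add: partial_add partial_mult complex_differentiable2_mult cds mixed_partials[OF S _ p] T12)
    ultimately have "partial_z ?g p - partial_w ?f p =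
      (partial_z g (T p) - partial_w f (T p)) * (partial_z T1 p * partial_w T2 p - partial_w T1 p * partial_z T2 p)"
      unfolding comp(2)[OF f p] comp(2)[OF g p] comp(3)[OF f p] comp(3)[OF g p] by (simp add: algebra_simps)
    then show ?thesis using closed[OF TS[OF p]] by simp
  qed
  ultimately show "\<exists>f' g'. holomorphic2_on f' (snd c ` (fst c \<inter> V)) \<and> holomorphic2_on g' (snd c ` (fst c \<inter> V)) \<and>
      (\<forall>y\<in>fst c \<inter> V. \<forall>v\<in>tangent_space X \<A> y.
         f (snd c0 y) * coord_dz c0 v + g (snd c0 y) * coord_dw c0 v =
         f' (snd c y) * coord_dz c v + g' (snd c y) * coord_dw c v) \<and>
      (\<forall>p\<in>snd c ` (fst c \<inter> V). partial_z g' p - partial_w f' p = 0)"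
    unfolding S_def by blast
qed

section \<open>Factorisation of the cubic form\<close>

lemma cubic_coefficients:
  fixes a b f0 f1 f2 g0 g1 g2 :: complex
  assumes "\<And>s t. (a * s + b * t) * s * t = (f0 * s + g0 * t) * (f1 * s + g1 * t) * (f2 * s + g2 * t)"
  shows "f0 * f1 * f2 = 0" "g0 * g1 * g2 = 0"
    "a = f0 * f1 * g2 + f0 * g1 * f2 + g0 * f1 * f2"
    "b = g0 * g1 * f2 + g0 * f1 * g2 + f0 * g1 * g2"
proof -
  show 1: "f0 * f1 * f2 = 0" using assms[of 1 0] by simp
  show 2: "g0 * g1 * g2 = 0" using assms[of 0 1] by simp
  have 3: "a + b = f0 * f1 * f2 + (f0 * f1 * g2 + f0 * g1 * f2 + g0 * f1 * f2)
      + (g0 * g1 * f2 + g0 * f1 * g2 + f0 * g1 * g2) + g0 * g1 * g2"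
    using assms[of 1 1] by (simp add: algebra_simps)
  have 4: "b - a = f0 * f1 * f2 - (f0 * f1 * g2 + f0 * g1 * f2 + g0 * f1 * f2)
      + (g0 * g1 * f2 + g0 * f1 * g2 + f0 * g1 * g2) - g0 * g1 * g2"
    using assms[of 1 "-1"] by (simp add: algebra_simps)
  have "a = ((a + b) - (b - a)) / 2" by simp
  also have "\<dots> = f0 * f1 * g2 + f0 * g1 * f2 + g0 * f1 * f2"
    unfolding 3 4 1 2 by (simp add: field_simps)
  finally show "a = f0 * f1 * g2 + f0 * g1 * f2 + g0 * f1 * f2" .
  with 3 show "b = g0 * g1 * f2 + g0 * f1 * g2 + f0 * g1 * g2"
    unfolding 1 2 by simp
qed

text \<open>Unique factorisation of the cubic form: one factor is proportional to \<open>s\<close> (the factor \<open>i\<close>), another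
  to \<open>t\<close> (the factor \<open>j\<close>). The conclusion lists only the coefficients that are nonzero, because these are open
  conditions: they fix the roles of the three factors near a point. Which coefficients vanish
  then follows from \<open>cubic_coefficients\<close>.\<close>

lemma cubic_factors:
  fixes a b :: complex and f g :: "nat \<Rightarrow> complex"
  assumes eq: "\<And>s t. (a * s + b * t) * s * t = (\<Prod>i<3. f i * s + g i * t)"
    and ab: "a \<noteq> 0" "b \<noteq> 0"
  obtains i j k where "{..<3} = {i, j, k}" "i \<noteq> j" "i \<noteq> k" "j \<noteq> k"
    "f i \<noteq> 0" "g j \<noteq> 0" "f k \<noteq> 0" "g k \<noteq> 0"
proof -
  have lt3: "{..<3} = {0, 1, 2 :: nat}" by auto
  have "\<And>s t. (a * s + b * t) * s * t = (f 0 * s + g 0 * t) * (f 1 * s + g 1 * t) * (f 2 * s + g 2 * t)"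
    using eq by (simp add: lt3 mult.assoc)
  note co = cubic_coefficients[OF this]
  have F: "(f 0 = 0 \<and> f 1 \<noteq> 0 \<and> f 2 \<noteq> 0) \<or> (f 0 \<noteq> 0 \<and> f 1 = 0 \<and> f 2 \<noteq> 0) \<or> (f 0 \<noteq> 0 \<and> f 1 \<noteq> 0 \<and> f 2 = 0)"
    using co(1,3) ab(1) by auto
  have G: "(g 0 = 0 \<and> g 1 \<noteq> 0 \<and> g 2 \<noteq> 0) \<or> (g 0 \<noteq> 0 \<and> g 1 = 0 \<and> g 2 \<noteq> 0) \<or> (g 0 \<noteq> 0 \<and> g 1 \<noteq> 0 \<and> g 2 = 0)"
    using co(2,4) ab(2) by auto
  have ne: "\<not> (f l = 0 \<and> g l = 0)" if "l \<in> {0, 1, 2}" for l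
    using co(3) ab(1) that by auto
  have perms: "{..<3} = {0, 1, 2::nat}" "{..<3} = {0, 2, 1::nat}" "{..<3} = {1, 0, 2::nat}"
    "{..<3} = {1, 2, 0::nat}" "{..<3} = {2, 0, 1::nat}" "{..<3} = {2, 1, 0::nat}" by auto
  have "(f 0 \<noteq> 0 \<and> g 1 \<noteq> 0 \<and> f 2 \<noteq> 0 \<and> g 2 \<noteq> 0) \<or>
    (f 0 \<noteq> 0 \<and> g 2 \<noteq> 0 \<and> f 1 \<noteq> 0 \<and> g 1 \<noteq> 0) \<or>
    (f 1 \<noteq> 0 \<and> g 0 \<noteq> 0 \<and> f 2 \<noteq> 0 \<and> g 2 \<noteq> 0) \<or>
    (f 1 \<noteq> 0 \<and> g 2 \<noteq> 0 \<and> f 0 \<noteq> 0 \<and> g 0 \<noteq> 0) \<or>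
    (f 2 \<noteq> 0 \<and> g 0 \<noteq> 0 \<and> f 1 \<noteq> 0 \<and> g 1 \<noteq> 0) \<or>
    (f 2 \<noteq> 0 \<and> g 1 \<noteq> 0 \<and> f 0 \<noteq> 0 \<and> g 0 \<noteq> 0)"
    using F G ne[of 0] ne[of 1] ne[of 2] by simp blast
  then consider "f 0 \<noteq> 0" "g 1 \<noteq> 0" "f 2 \<noteq> 0" "g 2 \<noteq> 0" | "f 0 \<noteq> 0" "g 2 \<noteq> 0" "f 1 \<noteq> 0" "g 1 \<noteq> 0" | "f 1 \<noteq> 0" "g 0 \<noteq> 0" "f 2 \<noteq> 0" "g 2 \<noteq> 0" | "f 1 \<noteq> 0" "g 2 \<noteq> 0" "f 0 \<noteq> 0" "g 0 \<noteq> 0" | "f 2 \<noteq> 0" "g 0 \<noteq> 0" "f 1 \<noteq> 0" "g 1 \<noteq> 0" | "f 2 \<noteq> 0" "g 1 \<noteq> 0" "f 0 \<noteq> 0" "g 0 \<noteq> 0"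
    by blast
  then show thesis
  proof cases
    case 1
    then show thesis by (intro that[OF perms(1)]) simp_all
  next
    case 2
    then show thesis by (intro that[OF perms(2)]) simp_all
  next
    case 3
    then show thesis by (intro that[OF perms(3)]) simp_all
  next
    case 4
    then show thesis by (intro that[OF perms(4)]) simp_all
  next
    case 5
    then show thesis by (intro that[OF perms(5)]) simp_all
  next
    case 6
    then show thesis by (intro that[OF perms(6)]) simp_all
  qed
qed

section \<open>The criterion for closedness\<close>

theorem theorem3:
  fixes X :: "'a topology" and \<A> :: "'a chart set" and \<eta> :: "'a differential"
    and x :: 'a and U :: "'a set" and \<phi> :: "'a \<Rightarrow> complex \<times> complex"
    and a b A B \<xi> :: "complex \<times> complex \<Rightarrow> complex"
  assumes surface: "complex_surface X \<A>"
    and eta: "symmetric_differential_on X \<A> 3 (topspace X) \<eta>"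
    and nondeg: "nondegenerate X \<A> 3 \<eta>"
    and x: "x \<in> topspace X"
    and coords: "(U, \<phi>) \<in> holomorphic_charts X \<A>" "x \<in> U"
    and a_holo: "\<forall>\<^sub>F p in nhds (\<phi> x). complex_differentiable2 a p"
    and b_holo: "\<forall>\<^sub>F p in nhds (\<phi> x). complex_differentiable2 b p"
    and a_nz: "\<forall>\<^sub>F p in nhds (\<phi> x). a p \<noteq> 0"
    and b_nz: "\<forall>\<^sub>F p in nhds (\<phi> x). b p \<noteq> 0"
    and eta_local: "\<forall>\<^sub>F y in nhdsin X x. \<forall>v\<in>tangent_space X \<A> y.
      \<eta> y v = (a (\<phi> y) * coord_dz (U, \<phi>) v + b (\<phi> y) * coord_dw (U, \<phi>) v)
                * coord_dz (U, \<phi>) v * coord_dw (U, \<phi>) v"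
    and A: "A = partial_z (\<lambda>p. partial_w a p / a p)"
    and B: "B = partial_z (\<lambda>p. partial_w b p / b p)"
    and AB: "\<forall>\<^sub>F p in nhds (\<phi> x). A p - B p \<noteq> 0"
    and xi: "\<xi> = (\<lambda>p. 1 / (A p - B p) *
      (a p * partial_z (\<lambda>q. b q / a q * B q) p - b p * partial_w (\<lambda>q. a q / b q * A q) p))"
  shows "closed_at X \<A> 3 \<eta> x \<longleftrightarrow>
    (\<forall>\<^sub>F p in nhds (\<phi> x). partial_z (\<lambda>q. \<xi> q / a q) p = A p) \<and>
    (\<forall>\<^sub>F p in nhds (\<phi> x). partial_w (\<lambda>q. \<xi> q / b q) p = B p)"
proof -
  define c0 where "c0 = (U, \<phi>)"
  have c0: "c0 \<in> holomorphic_charts X \<A>" "fst c0 = U" "snd c0 = \<phi>"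
    using coords(1) by (simp_all add: c0_def)
  have chart: "is_chart X c0" using c0(1) by (rule holomorphic_chartsD(1))
  obtain S where S: "openin X S" "x \<in> S" and eta_S: "\<And>y v. y \<in> S \<Longrightarrow> v \<in> tangent_space X \<A> y \<Longrightarrow>
      \<eta> y v = (a (\<phi> y) * coord_dz c0 v + b (\<phi> y) * coord_dw c0 v) * coord_dz c0 v * coord_dw c0 v"
    using eta_local x unfolding eventually_nhdsin c0_def by blast
  have "\<forall>\<^sub>F p in nhds (\<phi> x). complex_differentiable2 a p \<and> complex_differentiable2 b p \<and>
      a p \<noteq> 0 \<and> b p \<noteq> 0 \<and> A p - B p \<noteq> 0"
    using a_holo b_holo a_nz b_nz AB by eventually_elim blast
  then obtain N0 where N0: "open N0" "\<phi> x \<in> N0" and N0': "\<And>p. p \<in> N0 \<Longrightarrow>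
      complex_differentiable2 a p \<and> complex_differentiable2 b p \<and> a p \<noteq> 0 \<and> b p \<noteq> 0 \<and> A p - B p \<noteq> 0"
    unfolding eventually_nhds by blast
  have web: "web_coefficients N a b A B \<xi>" if "open N" "N \<subseteq> N0" for N
    using that N0' A B xi unfolding web_coefficients_def holomorphic2_on_def by blast
  show ?thesis
  proof
    assume "closed_at X \<A> 3 \<eta> x"
    then obtain V and \<zeta> :: "nat \<Rightarrow> 'a differential" where V: "openin X V" "x \<in> V"
      and \<zeta>: "\<And>i. i < 3 \<Longrightarrow> closed_1form_on X \<A> V (\<zeta> i)"
      and prod: "\<And>y v. y \<in> V \<Longrightarrow> v \<in> tangent_space X \<A> y \<Longrightarrow> \<eta> y v = (\<Prod>i<3. \<zeta> i y v)"
      unfolding closed_at_def by blast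
    define R where "R = (\<lambda>i f g. holomorphic2_on f (\<phi> ` (U \<inter> V)) \<and> holomorphic2_on g (\<phi> ` (U \<inter> V)) \<and>
        (\<forall>y\<in>U \<inter> V. \<forall>v\<in>tangent_space X \<A> y.
           \<zeta> i y v = f (\<phi> y) * coord_dz c0 v + g (\<phi> y) * coord_dw c0 v) \<and>
        (\<forall>p\<in>\<phi> ` (U \<inter> V). partial_z g p - partial_w f p = 0))"
    have "\<exists>f g. R i f g" if "i < 3" for i
      using bspec[OF \<zeta>[OF that, unfolded closed_1form_on_def] c0(1)] unfolding R_def c0 .
    then obtain f g where R: "\<And>i. i < 3 \<Longrightarrow> R i (f i) (g i)"
      by metis
    have fg: "holomorphic2_on (f i) (\<phi> ` (U \<inter> V))" "holomorphic2_on (g i) (\<phi> ` (U \<inter> V))"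
      if "i < 3" for i
      using R[OF that] by (auto simp: R_def)
    have \<zeta>_eq: "\<zeta> i y v = f i (\<phi> y) * coord_dz c0 v + g i (\<phi> y) * coord_dw c0 v"
      if "i < 3" "y \<in> U \<inter> V" "v \<in> tangent_space X \<A> y" for i y v
      using R[OF that(1)] that(2,3) by (auto simp: R_def)
    have closed: "partial_z (g i) p = partial_w (f i) p" if "i < 3" "p \<in> \<phi> ` (U \<inter> V)" for i p
      using R[OF that(1)] that(2) by (auto simp: R_def)
    \<comment> \<open>A neighbourhood on which the coordinate expression and the factorisation of \<open>\<eta>\<close> both hold.\<close>
    define N1 where "N1 = \<phi> ` (U \<inter> (V \<inter> S)) \<inter> N0"
    have N1: "open N1" "\<phi> x \<in> N1"
      using chart_open_image[OF chart openin_Int[OF V(1) S(1)]] N0 V(2) S(2) coords(2)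
      by (auto simp: N1_def c0)
    have cubic: "(a p * s + b p * t) * s * t = (\<Prod>i<3. f i p * s + g i p * t)" if p: "p \<in> N1" for p s t
    proof -
      obtain y where y: "y \<in> U" "y \<in> V" "y \<in> S" "p = \<phi> y"
        using p by (auto simp: N1_def)
      then have "c0 \<in> charts_at X \<A> y" using c0 by (auto simp: charts_at_def)
      then obtain v where v: "v \<in> tangent_space X \<A> y" "v c0 = (s, t)"
        using tangent_vector_exists[OF surface] by metis
      have "(a p * s + b p * t) * s * t = \<eta> y v"
        using eta_S[OF y(3) v(1)] v(2) y(4) by (simp add: coord_dz_def coord_dw_def)
      also have "\<dots> = (\<Prod>i<3. \<zeta> i y v)"
        by (rule prod[OF y(2) v(1)])
      also have "\<dots> = (\<Prod>i<3. f i p * s + g i p * t)"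
        by (rule prod.cong) (use y v \<zeta>_eq[of _ y v] in \<open>auto simp: coord_dz_def coord_dw_def\<close>)
      finally show ?thesis .
    qed
    \<comment> \<open>The roles of the three factors are read off at \<open>x\<close> and persist nearby by continuity.\<close>
    have abx: "a (\<phi> x) \<noteq> 0" "b (\<phi> x) \<noteq> 0" using N0 N0' by auto
    obtain i j k where ijk: "{..<3} = {i, j, k}" "i \<noteq> j" "i \<noteq> k" "j \<noteq> k"
      and nz: "f i (\<phi> x) \<noteq> 0" "g j (\<phi> x) \<noteq> 0" "f k (\<phi> x) \<noteq> 0" "g k (\<phi> x) \<noteq> 0"
      using cubic_factors[OF cubic[OF N1(2)] abx] by metis
    have lt: "i < 3" "j < 3" "k < 3" using ijk(1) by auto
    have N1_sub: "N1 \<subseteq> \<phi> ` (U \<inter> V)" by (auto simp: N1_def)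
    have hol: "holomorphic2_on (f l) N1" "holomorphic2_on (g l) N1" if "l < 3" for l
      using fg[OF that] N1_sub holomorphic2_on_subset by blast+
    have ev: "\<forall>\<^sub>F p in nhds (\<phi> x). F p \<noteq> 0" if "holomorphic2_on F N1" "F (\<phi> x) \<noteq> 0" for F
    proof -
      have "isCont F (\<phi> x)"
        using holomorphic2_on_imp_sep[OF that(1)] N1 by (auto simp: sep_holomorphic_on_def continuous_on_eq_continuous_at)
      then have "(F \<longlongrightarrow> F (\<phi> x)) (nhds (\<phi> x))"
        by (simp add: isCont_def tendsto_at_iff_tendsto_nhds)
      from topological_tendstoD[OF this, of "- {0}"] show ?thesis
        using that(2) by auto
    qed
    have "\<forall>\<^sub>F p in nhds (\<phi> x). p \<in> N1 \<and> f i p \<noteq> 0 \<and> g j p \<noteq> 0 \<and> f k p \<noteq> 0 \<and> g k p \<noteq> 0"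
      using eventually_nhds_in_open[OF N1] ev[OF hol(1)[OF lt(1)] nz(1)] ev[OF hol(2)[OF lt(2)] nz(2)]
        ev[OF hol(1)[OF lt(3)] nz(3)] ev[OF hol(2)[OF lt(3)] nz(4)] by eventually_elim blast
    then obtain N where N: "open N" "\<phi> x \<in> N"
      and N': "\<And>p. p \<in> N \<Longrightarrow> p \<in> N1 \<and> f i p \<noteq> 0 \<and> g j p \<noteq> 0 \<and> f k p \<noteq> 0 \<and> g k p \<noteq> 0"
      unfolding eventually_nhds by blast
    have "N \<subseteq> N0" using N' by (auto simp: N1_def)
    then interpret web_coefficients N a b A B \<xi> using web N(1) by blast
    have coeffs: "g i p = 0" "f j p = 0" "f i p * g j p * f k p = a p" "f i p * g j p * g k p = b p"
      if p: "p \<in> N" for p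
    proof -
      have "(\<Prod>l<3. f l p * s + g l p * t) = (f i p * s + g i p * t) * (f j p * s + g j p * t) * (f k p * s + g k p * t)" for s t
        unfolding ijk(1) using ijk(2-4) by (simp add: mult.assoc)
      with cubic[of p] N'[OF p] have
        "\<And>s t. (a p * s + b p * t) * s * t = (f i p * s + g i p * t) * (f j p * s + g j p * t) * (f k p * s + g k p * t)"
        by simp
      note co = cubic_coefficients[OF this]
      show 1: "g i p = 0" and 2: "f j p = 0" using co(1,2) N'[OF p] by auto
      show "f i p * g j p * f k p = a p" "f i p * g j p * g k p = b p"
        using co(3,4) 1 2 by auto
    qed
    have sub: "p \<in> \<phi> ` (U \<inter> V)" if "p \<in> N" for p using N'[OF that] N1_sub by auto
    have N_sub: "N \<subseteq> N1" using N' by blast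
    \<comment> \<open>A factor proportional to \<open>dz\<close> is closed only if its coefficient depends on \<open>z\<close> alone.\<close>
    have Pw: "partial_w (f i) p = 0" if p: "p \<in> N" for p
    proof -
      have "partial_w (f i) p = partial_z (g i) p" using closed[OF lt(1) sub[OF p]] by simp
      also have "\<dots> = partial_z (\<lambda>_. 0) p" by (rule partial_z_cong[OF N(1) p]) (rule coeffs)
      finally show ?thesis by simp
    qed
    have Qz: "partial_z (g j) p = 0" if p: "p \<in> N" for p
    proof -
      have "partial_z (g j) p = partial_w (f j) p" by (rule closed[OF lt(2) sub[OF p]])
      also have "\<dots> = partial_w (\<lambda>_. 0) p" by (rule partial_w_cong[OF N(1) p]) (rule coeffs)
      finally show ?thesis by simp
    qed
    note xi_equations = xi_equations_of_closed_factors[OF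
        holomorphic2_on_subset[OF hol(1)[OF lt(1)] N_sub] Pw holomorphic2_on_subset[OF hol(2)[OF lt(2)] N_sub] Qz
        holomorphic2_on_subset[OF hol(1)[OF lt(3)] N_sub] coeffs(3)
        holomorphic2_on_subset[OF hol(2)[OF lt(3)] N_sub] coeffs(4) closed[OF lt(3) sub]]
    show "(\<forall>\<^sub>F p in nhds (\<phi> x). partial_z (\<lambda>q. \<xi> q / a q) p = A p) \<and>
      (\<forall>\<^sub>F p in nhds (\<phi> x). partial_w (\<lambda>q. \<xi> q / b q) p = B p)"
      using N xi_equations unfolding eventually_nhds by blast
  next
    assume "(\<forall>\<^sub>F p in nhds (\<phi> x). partial_z (\<lambda>q. \<xi> q / a q) p = A p) \<and>
      (\<forall>\<^sub>F p in nhds (\<phi> x). partial_w (\<lambda>q. \<xi> q / b q) p = B p)"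
    then have "\<forall>\<^sub>F p in nhds (\<phi> x). p \<in> N0 \<and> partial_z (\<lambda>q. \<xi> q / a q) p = A p \<and> partial_w (\<lambda>q. \<xi> q / b q) p = B p"
      using eventually_nhds_in_open[OF N0] by (auto intro: eventually_conj)
    then obtain N where N: "open N" "\<phi> x \<in> N" and N': "\<And>p. p \<in> N \<Longrightarrow>
        p \<in> N0 \<and> partial_z (\<lambda>q. \<xi> q / a q) p = A p \<and> partial_w (\<lambda>q. \<xi> q / b q) p = B p"
      unfolding eventually_nhds by blast
    have "N \<subseteq> N0" using N' by blast
    then interpret web_coefficients N a b A B \<xi> using web N(1) by blast
    obtain r where r: "r > 0" "cball (fst (\<phi> x)) r \<times> cball (snd (\<phi> x)) r \<subseteq> N"
      using open_contains_bidisc[OF N] by blast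
    define D where "D = ball (fst (\<phi> x)) r \<times> ball (snd (\<phi> x)) r"
    have D: "open D" "\<phi> x \<in> D" "D \<subseteq> N"
      using r by (auto simp: D_def open_Times mem_Times_iff subset_iff)
    obtain P Q h where P: "holomorphic2_on P D" "\<And>p. p \<in> D \<Longrightarrow> partial_w P p = 0"
      and Q: "holomorphic2_on Q D" "\<And>p. p \<in> D \<Longrightarrow> partial_z Q p = 0"
      and h: "holomorphic2_on h D" "\<And>p. P p * Q p * h p = 1"
        "\<And>p. p \<in> D \<Longrightarrow> partial_z (\<lambda>q. h q * b q) p = partial_w (\<lambda>q. h q * a q) p"
    proof (rule closed_factors_of_xi_equations[of "fst (\<phi> x)" r "snd (\<phi> x)", folded D_def])
      show "D \<subseteq> N" by (rule D(3))
    qed (use N' in auto)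
    define V where "V = {y \<in> fst c0. snd c0 y \<in> D} \<inter> S"
    have V: "openin X V" "x \<in> V" "V \<subseteq> fst c0" "V \<subseteq> S" "snd c0 ` V \<subseteq> D"
      using chart_openin_preimage[OF chart D(1)] S coords(2) D(2) by (auto simp: V_def c0)
    \<comment> \<open>The three factors \<open>P dz\<close>, \<open>Q dw\<close> and \<open>h (a dz + b dw)\<close>, as \<open>F i dz + G i dw\<close>.\<close>
    define F where "F = (\<lambda>i::nat. if i = 0 then P else if i = 1 then (\<lambda>_. 0) else (\<lambda>q. h q * a q))"
    define G where "G = (\<lambda>i::nat. if i = 0 then (\<lambda>_. 0) else if i = 1 then Q else (\<lambda>q. h q * b q))"
    define \<zeta> where "\<zeta> = (\<lambda>i y v. F i (snd c0 y) * coord_dz c0 v + G i (snd c0 y) * coord_dw c0 v)"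
    have ab_D: "holomorphic2_on a D" "holomorphic2_on b D"
      using holomorphic2_on_subset[OF a_hol D(3)] holomorphic2_on_subset[OF b_hol D(3)] by auto
    have FG: "holomorphic2_on (F i) D" "holomorphic2_on (G i) D" for i
      using P(1) Q(1) h(1) ab_D by (auto simp: F_def G_def intro!: holomorphic2_on_mult holomorphic2_on_const)
    have FG_closed: "partial_z (G i) p = partial_w (F i) p" if "p \<in> D" for i p
      using P(2) Q(2) h(3) that by (simp add: F_def G_def)
    have "closed_1form_on X \<A> V (\<zeta> i)" for i
      unfolding \<zeta>_def
      by (intro closed_1form_onI surface c0(1) V(1,3) holomorphic2_on_subset[OF FG(1) V(5)]
          holomorphic2_on_subset[OF FG(2) V(5)] FG_closed subsetD[OF V(5)])
    moreover have "\<eta> y v = (\<Prod>i<3. \<zeta> i y v)" if "y \<in> V" "v \<in> tangent_space X \<A> y" for y v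
    proof -
      have "\<eta> y v = (P (\<phi> y) * Q (\<phi> y) * h (\<phi> y)) *
          ((a (\<phi> y) * coord_dz c0 v + b (\<phi> y) * coord_dw c0 v) * coord_dz c0 v * coord_dw c0 v)"
        using eta_S[of y v] that V(4) h(2) by auto
      also have "\<dots> = (\<Prod>i<3. \<zeta> i y v)"
        by (simp add: numeral_3_eq_3 lessThan_Suc \<zeta>_def F_def G_def c0 algebra_simps)
      finally show ?thesis .
    qed
    ultimately show "closed_at X \<A> 3 \<eta> x"
      unfolding closed_at_def using V(1,2) by blast
  qed
qed

end
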